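(* Let $T$ be a bounded linear operator on a separable complex Banach space $X$ with the $\mathscr P_{\overline{\mathcal{BD}}}$ property, and let $\lambda\in\mathbb C$ with $|\lambda|=1$. Then either $T=\lambda\,\mathrm{Id}$ or $T-\lambda\,\mathrm{Id}$ is not quasinilpotent.
   Context: $N_T(x,U)=\{n\in\mathbb N:T^nx\in U\}$. $\overline{\mathcal{BD}}$ is the family of sets $A\subseteq\mathbb N$ of positive upper Banach density, $\lim_n\sup_k\#(A\cap[k,k+n])/n>0$. $T$ has the $\mathscr P_{\overline{\mathcal{BD}}}$ property if for every nonempty open $U\subseteq X$ there is $x\in X$ with $N_T(x,U)\in\overline{\mathcal{BD}}$. An operator is quasinilpotent if its spectrum is $\{0\}$. *)

theory Defs
  imports "HOL-Analysis.Analysis"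
begin

text \<open>Complex Banach spaces: the library has no complex normed vector class,
so we equip a (real) Banach space with a complex scalar multiplication
compatible with the real one and with the norm.\<close>

class complex_banach = banach +
  fixes scaleC :: "complex \<Rightarrow> 'a \<Rightarrow> 'a" (infixr "*\<^sub>C" 75)
  assumes scaleC_add_right: "a *\<^sub>C (x + y) = a *\<^sub>C x + a *\<^sub>C y"
    and scaleC_add_left: "(a + b) *\<^sub>C x = a *\<^sub>C x + b *\<^sub>C x"
    and scaleC_scaleC: "a *\<^sub>C (b *\<^sub>C x) = (a * b) *\<^sub>C x"
    and scaleC_one: "1 *\<^sub>C x = x"
    and scaleC_of_real: "complex_of_real r *\<^sub>C x = r *\<^sub>R x"
    and norm_scaleC: "norm (a *\<^sub>C x) = cmod a * norm x"

definition bounded_clinear_op :: "('a::complex_banach \<Rightarrow> 'a) \<Rightarrow> bool" where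
  "bounded_clinear_op T \<longleftrightarrow>
     (\<forall>x y. T (x + y) = T x + T y) \<and> (\<forall>a x. T (a *\<^sub>C x) = a *\<^sub>C T x) \<and>
     (\<exists>K. \<forall>x. norm (T x) \<le> K * norm x)"

definition op_spectrum :: "('a::complex_banach \<Rightarrow> 'a) \<Rightarrow> complex set" where
  "op_spectrum T = {\<mu>. \<not> (\<exists>S. bounded_clinear_op S \<and>
        (\<forall>x. S (T x - \<mu> *\<^sub>C x) = x) \<and> (\<forall>x. T (S x) - \<mu> *\<^sub>C S x = x))}"

definition quasinilpotent :: "('a::complex_banach \<Rightarrow> 'a) \<Rightarrow> bool" where
  "quasinilpotent T \<longleftrightarrow> op_spectrum T = {0}"

definition separable_space :: "'a::topological_space itself \<Rightarrow> bool" where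
  "separable_space _ \<longleftrightarrow> (\<exists>D::'a set. countable D \<and> closure D = UNIV)"

definition return_set :: "('a \<Rightarrow> 'a) \<Rightarrow> 'a \<Rightarrow> 'a set \<Rightarrow> nat set" where
  "return_set T x U = {n. (T ^^ n) x \<in> U}"

text \<open>Positive upper Banach density: lim_n sup_k #(A \<inter> [k,k+n]) / n > 0
(the limit always exists).\<close>
definition pos_upper_banach_density :: "nat set \<Rightarrow> bool" where
  "pos_upper_banach_density A \<longleftrightarrow>
     (\<exists>L>0. ((\<lambda>n. (SUP k. real (card (A \<inter> {k..k+n}))) / real n) \<longlongrightarrow> L) sequentially)"

definition P_BD :: "('a::topological_space \<Rightarrow> 'a) \<Rightarrow> bool" where
  "P_BD T \<longleftrightarrow> (\<forall>U. open U \<and> U \<noteq> {} \<longrightarrow> (\<exists>x. pos_upper_banach_density (return_set T x U)))"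

end

(*
Put S = T / lam and Q = S - 1, so that Q is quasinilpotent; by a roots-of-unity average of the
resolvent, |Q^m| <= C eps^m for every eps > 0. For a functional phi the scalar sequence
n |-> phi (S^n y) has m-th differences phi (Q^m S^n y), so it has few sign changes relative to any
level (discrete Rolle). If the orbit of y visits a ball with positive upper Banach density, then
some visit time is the centre of a long interval on which phi (S^n y) is bounded. Long bounded
stretches force phi (u x) to be small, where u = (2 - S - S^-1) / 4 plays the role of
sin^2 (theta / 2): with v = 4 u (1 - u) a bound C on all |phi (v^j x)|, j >= 1, gives C / 2 on all
|phi (u^j x)|, and v is again of the same kind with S replaced by S^2. Since the constant does not
depend on the ball, u = 0. Then S^n = 1 + n Q, and boundedness gives Q = 0.
*)
theory Submission
  imports Defs
begin

section \<open>Norming functionals\<close>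

text \<open>Positive Banach density gives no control over where the dense windows lie, and between
  returns the orbit is controlled only by crude exponential growth. No norm bound along a window is
  available; counting sign changes bounds finitely many functionals at a time, by a pigeonhole over
  them. This fixes the order of choices: to show \<open>E v = 0\<close>, take a functional norming
  \<open>E v\<close>, then a window length, and only then an orbit. The bound
  \<open>2 * (norm v + 1)\<close> serves every window length and every radius up to 1, so longer
  windows can buy smallness at the centre while the radius shrinks. A return of \<open>T\<close> to
  \<open>v\<close> is a return of \<open>S\<close> to \<open>v\<close> times an unknown phase, so
  the functional is paired with its composition with multiplication by i; with signs this makes four
  real functionals. The 4 in \<open>4 u (1 - u)\<close> is that of sin^2(2a) = 4 sin^2 a (1 - sin^2
  a); p doublings divide the bound by 2^p and make each application reach 2^p steps further.\<close>

definition sublinear :: "('a::real_vector \<Rightarrow> real) \<Rightarrow> bool" where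
  "sublinear p \<longleftrightarrow> (\<forall>x y. p (x + y) \<le> p x + p y) \<and> (\<forall>t x. t \<ge> 0 \<longrightarrow> p (t *\<^sub>R x) = t * p x)"

lemma sublinear_zero: "sublinear p \<Longrightarrow> p 0 = 0"
  unfolding sublinear_def by (metis mult_zero_left order_refl scaleR_zero_left)

lemma sublinear_ge_neg: assumes "sublinear p" shows "- p (- x) \<le> p x"
proof -
  have "p (x + (- x)) \<le> p x + p (- x)" using assms unfolding sublinear_def by blast
  then show ?thesis using sublinear_zero[OF assms] by simp
qed

text \<open>A minimal \<open>p\<close> equals such a \<open>q\<close>, and then the last clause at \<open>t = 1\<close> is additivity.\<close>

lemma sublinear_below_direction:
  assumes p: "sublinear p"
  obtains q where "sublinear q" "\<And>x. q x \<le> p x" "\<And>x t. t \<ge> 0 \<Longrightarrow> q x \<le> p (x + t *\<^sub>R v) - t * p v"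
proof
  define f where "f x t = p (x + t *\<^sub>R v) - t * p v" for x t
  define q where "q x = (INF t\<in>{0..}. f x t)" for x
  have add: "p (x + y) \<le> p x + p y" for x y using p unfolding sublinear_def by blast
  have hom: "t \<ge> 0 \<Longrightarrow> p (t *\<^sub>R x) = t * p x" for t x using p unfolding sublinear_def by blast
  have lb: "- p (- x) \<le> f x t" if "t \<ge> 0" for x t
    using add[of "x + t *\<^sub>R v" "- x"] hom[OF that, of v] by (simp add: f_def)
  have bdd: "bdd_below (f x ` {0..})" for x
    by (rule bdd_belowI2[of _ "- p (- x)"]) (use lb in auto)
  have qle: "q x \<le> f x t" if "t \<ge> 0" for x t
    unfolding q_def by (rule cINF_lower[OF bdd]) (use that in auto)
  show "q x \<le> p (x + t *\<^sub>R v) - t * p v" if "t \<ge> 0" for x t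
    using qle[OF that] by (simp add: f_def)
  show "q x \<le> p x" for x using qle[of 0 x] by (simp add: f_def)
  have qge: "c \<le> q x" if "\<And>t. t \<ge> 0 \<Longrightarrow> c \<le> f x t" for c x
    unfolding q_def by (rule cINF_greatest) (use that in auto)
  have "q (x + y) \<le> q x + q y" for x y
  proof -
    have *: "q (x + y) \<le> f x s + f y t" if "s \<ge> 0" "t \<ge> 0" for s t
      using qle[of "s + t" "x + y"] that add[of "x + s *\<^sub>R v" "y + t *\<^sub>R v"]
      by (simp add: f_def algebra_simps)
    have "q (x + y) - f x s \<le> q y" if "s \<ge> 0" for s
      by (rule qge) (use * that in \<open>simp add: algebra_simps\<close>)
    then have "q (x + y) - q y \<le> q x" by (intro qge) (simp add: algebra_simps)
    then show ?thesis by simp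
  qed
  moreover have "q (t *\<^sub>R x) = t * q x" if "t \<ge> 0" for t x
  proof (cases "t = 0")
    case True
    have "f 0 s = 0" if "s \<ge> 0" for s using hom[OF that] by (simp add: f_def)
    then have "q 0 = 0" by (intro antisym qge order_trans[OF qle[of 0]]) auto
    then show ?thesis using True by simp
  next
    case False
    have fs: "f (t *\<^sub>R x) (t * s) = t * f x s" if "s \<ge> 0" for s
      using hom[OF \<open>t \<ge> 0\<close>, of "x + s *\<^sub>R v"] by (simp add: f_def algebra_simps)
    have "q (t *\<^sub>R x) / t \<le> q x"
    proof (rule qge)
      fix s :: real assume "s \<ge> 0"
      then show "q (t *\<^sub>R x) / t \<le> f x s"
        using fs[of s] qle[of "t * s" "t *\<^sub>R x"] that False by (simp add: field_simps)
    qed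
    moreover have "t * q x \<le> q (t *\<^sub>R x)"
    proof (rule qge)
      fix s :: real assume "s \<ge> 0"
      then show "t * q x \<le> f (t *\<^sub>R x) s"
        using fs[of "s / t"] qle[of "s / t" x] that False by (simp add: mult_left_mono)
    qed
    ultimately show ?thesis using False that by (simp add: field_simps)
  qed
  ultimately show "sublinear q" unfolding sublinear_def by blast
qed

lemma minimal_sublinear_imp_linear:
  assumes p: "sublinear p" and min: "\<And>q. sublinear q \<Longrightarrow> (\<And>x. q x \<le> p x) \<Longrightarrow> q = p"
  shows "linear p"
proof -
  have add: "p (x + y) = p x + p y" for x y
  proof (rule antisym)
    show "p (x + y) \<le> p x + p y" using p unfolding sublinear_def by blast
    obtain q where q: "sublinear q" "\<And>x. q x \<le> p x"
      and "\<And>x t. t \<ge> 0 \<Longrightarrow> q x \<le> p (x + t *\<^sub>R y) - t * p y"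
      using sublinear_below_direction[OF p, of y] by metis
    then have "q x \<le> p (x + 1 *\<^sub>R y) - 1 * p y" by (meson zero_le_one)
    then show "p x + p y \<le> p (x + y)" using min[OF q] by simp
  qed
  have neg: "p (- x) = - p x" for x
    using add[of x "- x"] sublinear_zero[OF p] by simp
  have "p (t *\<^sub>R x) = t * p x" for t x
  proof (cases "t \<ge> 0")
    case False
    then have "p ((- t) *\<^sub>R x) = (- t) * p x" using p unfolding sublinear_def
      by (metis linorder_not_less neg_0_le_iff_le order_le_less)
    then show ?thesis using neg[of "t *\<^sub>R x"] by simp
  qed (use p in \<open>auto simp: sublinear_def\<close>)
  then show ?thesis using add by (intro linearI) auto
qed

lemma sublinear_Inf_chain:
  assumes C: "C \<noteq> {}" "\<And>p. p \<in> C \<Longrightarrow> sublinear p" "\<And>p x. p \<in> C \<Longrightarrow> p x \<le> norm x"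
    and chain: "\<And>p q. p \<in> C \<Longrightarrow> q \<in> C \<Longrightarrow> p \<le> q \<or> q \<le> p"
  shows "sublinear (\<lambda>x::'a::real_normed_vector. INF p\<in>C. p x)"
    and "\<And>p x. p \<in> C \<Longrightarrow> (INF p\<in>C. p x) \<le> p x"
proof -
  have lb: "- norm x \<le> p x" if "p \<in> C" for p x
    using sublinear_ge_neg[OF C(2)[OF that], of x] C(3)[OF that, of "- x"] by simp
  have bdd: "bdd_below ((\<lambda>p. p x) ` C)" for x
    by (rule bdd_belowI2[of _ "- norm x"]) (rule lb)
  show le: "(INF p\<in>C. p x) \<le> p x" if "p \<in> C" for p x by (rule cINF_lower[OF bdd that])
  have ge: "c \<le> (INF p\<in>C. p x)" if "\<And>p. p \<in> C \<Longrightarrow> c \<le> p x" for c x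
    by (rule cINF_greatest[OF C(1)]) (rule that)
  have "(INF p\<in>C. p (x + y)) \<le> (INF p\<in>C. p x) + (INF p\<in>C. p y)" for x y
  proof -
    \<comment> \<open>The two infima on the right range over independent \<open>p\<close> and
      \<open>q\<close>; the chain supplies one \<open>r\<close> below both, to which subadditivity
      applies.\<close>
    have *: "(INF p\<in>C. p (x + y)) \<le> p x + q y" if pq: "p \<in> C" "q \<in> C" for p q
    proof -
      obtain r where r: "r \<in> C" "r \<le> p" "r \<le> q"
        using chain[OF pq] pq by (metis order_refl)
      have "(INF p\<in>C. p (x + y)) \<le> r (x + y)" by (rule le[OF r(1)])
      also have "\<dots> \<le> r x + r y" using C(2)[OF r(1)] unfolding sublinear_def by blast
      also have "\<dots> \<le> p x + q y" using r by (auto simp: le_fun_def intro: add_mono)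
      finally show ?thesis .
    qed
    have "(INF p\<in>C. p (x + y)) - p x \<le> (INF p\<in>C. p y)" if "p \<in> C" for p
      by (rule ge) (use *[OF that] in \<open>simp add: diff_le_eq add.commute\<close>)
    then have "(INF p\<in>C. p (x + y)) - (INF p\<in>C. p y) \<le> (INF p\<in>C. p x)"
      by (intro ge) (simp add: algebra_simps)
    then show ?thesis by simp
  qed
  moreover have "(INF p\<in>C. p (t *\<^sub>R x)) = t * (INF p\<in>C. p x)" if "t \<ge> 0" for t x
  proof -
    have h: "p (t *\<^sub>R x) = t * p x" if "p \<in> C" for p
      using C(2)[OF that] \<open>t \<ge> 0\<close> unfolding sublinear_def by blast
    show ?thesis
    proof (cases "t = 0")
      case True
      have "(\<lambda>p. p 0) ` C = {0}" using h C(1) True by force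
      then show ?thesis using True by simp
    next
      case False
      have "(INF p\<in>C. p (t *\<^sub>R x)) / t \<le> (INF p\<in>C. p x)"
        by (rule ge) (use False that h le in \<open>force simp: field_simps\<close>)
      moreover have "t * (INF p\<in>C. p x) \<le> (INF p\<in>C. p (t *\<^sub>R x))"
        by (rule ge) (use that in \<open>simp add: h le mult_left_mono\<close>)
      ultimately show ?thesis using False that by (simp add: field_simps)
    qed
  qed
  ultimately show "sublinear (\<lambda>x. INF p\<in>C. p x)" unfolding sublinear_def by blast
qed

text \<open>Hahn-Banach by minimality. The constraint \<open>p (- v) \<le> - norm v\<close> turns
  into \<open>p v = norm v\<close> once \<open>p\<close> is linear, and it passes to every smaller
  map, so minimality inside \<open>F\<close> is minimality among all sublinear maps.\<close>

lemma norming_functional: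
  fixes v :: "'a::real_normed_vector"
  obtains \<phi> :: "'a \<Rightarrow> real" where "linear \<phi>" "\<And>x. \<bar>\<phi> x\<bar> \<le> norm x" "\<phi> v = norm v"
proof -
  define F :: "('a \<Rightarrow> real) set" where
    "F = {p. sublinear p \<and> (\<forall>x. p x \<le> norm x) \<and> p (- v) \<le> - norm v}"
  have "sublinear (norm :: 'a \<Rightarrow> real)"
    by (auto simp: sublinear_def norm_triangle_ineq)
  then obtain q :: "'a \<Rightarrow> real" where q: "sublinear q" "\<And>x. q x \<le> norm x"
      "\<And>x t. t \<ge> 0 \<Longrightarrow> q x \<le> norm (x + t *\<^sub>R v) - t * norm v"
    using sublinear_below_direction[of norm v] by metis
  \<comment> \<open>\<open>F\<close> is nonempty: the norm lowered along \<open>v\<close> meets the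
    argument \<open>- v + v = 0\<close> at \<open>t = 1\<close>.\<close>
  have "q (- v) \<le> - norm v" using q(3)[of 1 "- v"] by simp
  then have qF: "q \<in> F" using q by (auto simp: F_def)
  have "\<exists>m\<in>F. \<forall>a\<in>F. (\<lambda>p q. q \<le> p) m a \<longrightarrow> a = m"
  proof (rule predicate_Zorn[OF partial_order_on_relation_ofI])
    fix C assume "C \<in> Chains (relation_of (\<lambda>p q. q \<le> p) F)"
    then have CF: "C \<subseteq> F" and ch: "\<And>p q. p \<in> C \<Longrightarrow> q \<in> C \<Longrightarrow> p \<le> q \<or> q \<le> p"
      by (auto simp: Chains_def relation_of_def)
    show "\<exists>u\<in>F. \<forall>a\<in>C. u \<le> a"
    proof (cases "C = {}")
      case True then show ?thesis using qF by auto
    next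
      case False
      have 1: "sublinear (\<lambda>x. INF p\<in>C. p x)" "\<And>p x. p \<in> C \<Longrightarrow> (INF p\<in>C. p x) \<le> p x"
        using sublinear_Inf_chain[of C] False CF ch by (auto simp: F_def)
      obtain p where "p \<in> C" using False by blast
      then have "(\<lambda>x. INF p\<in>C. p x) \<in> F"
        using 1 CF unfolding F_def by (fastforce intro: order_trans[OF 1(2)[of p]])
      then show ?thesis using 1(2) by (intro bexI) (auto simp: le_fun_def)
    qed
  qed auto
  then obtain p where p: "p \<in> F" and min: "\<And>q. q \<in> F \<Longrightarrow> q \<le> p \<Longrightarrow> q = p" by blast
  have lin: "linear p"
  proof (rule minimal_sublinear_imp_linear)
    fix q assume q: "sublinear q" "\<And>x. q x \<le> p x"
    then have "q \<in> F" using p unfolding F_def by (auto intro: order_trans)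
    then show "q = p" using min q(2) by (auto simp: le_fun_def)
  qed (use p in \<open>auto simp: F_def\<close>)
  have le: "p x \<le> norm x" for x using p by (auto simp: F_def)
  have neg: "p (- x) = - p x" for x using lin by (simp add: linear_neg)
  have "\<bar>p x\<bar> \<le> norm x" for x using le[of x] le[of "- x"] neg[of x] by simp
  moreover have "p v = norm v" using le[of v] p neg[of v] by (auto simp: F_def)
  ultimately show ?thesis using that lin by blast
qed

section \<open>Spectrum zero implies superexponential decay of the powers\<close>

lemma linear_scaleC: "linear (\<lambda>x::'a::complex_banach. a *\<^sub>C x)"
proof (rule linearI)
  fix c :: real and x :: 'a
  show "a *\<^sub>C (c *\<^sub>R x) = c *\<^sub>R a *\<^sub>C x"
    by (simp add: scaleC_scaleC mult.commute flip: scaleC_of_real)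
qed (rule scaleC_add_right)

lemma scaleC_zero_left [simp]: "0 *\<^sub>C x = (0::'a::complex_banach)"
  using norm_scaleC[of 0 x] by simp

lemmas scaleC_diff_right = linear_diff[OF linear_scaleC]
lemmas scaleC_minus_right = linear_neg[OF linear_scaleC]

lemma scaleC_minus_left: "(- a) *\<^sub>C x = - (a *\<^sub>C (x::'a::complex_banach))"
  using scaleC_add_left[of a "- a" x] by (simp add: eq_neg_iff_add_eq_0 add.commute)

lemma scaleC_diff_left: "(a - b) *\<^sub>C x = a *\<^sub>C x - b *\<^sub>C (x::'a::complex_banach)"
  using scaleC_add_left[of a "- b" x] by (simp add: scaleC_minus_left)

lemma scaleC_sum_left: "(\<Sum>j\<in>J. f j) *\<^sub>C x = (\<Sum>j\<in>J. f j *\<^sub>C (x::'a::complex_banach))"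
  by (induction J rule: infinite_finite_induct) (simp_all add: scaleC_add_left)

lemma bounded_clinear_op_bounded_linear:
  assumes "bounded_clinear_op (T :: 'a::complex_banach \<Rightarrow> 'a)"
  shows "bounded_linear T"
proof -
  obtain K where "\<And>x. norm (T x) \<le> K * norm x" using assms unfolding bounded_clinear_op_def by blast
  moreover have "T (r *\<^sub>R x) = r *\<^sub>R T x" for r x
    using assms unfolding bounded_clinear_op_def by (metis scaleC_of_real)
  ultimately show ?thesis
    using assms by (intro bounded_linear_intro[of T K]) (auto simp: bounded_clinear_op_def mult.commute)
qed

lemma linear_funpow: "linear (T :: 'a::real_vector \<Rightarrow> 'a) \<Longrightarrow> linear (T ^^ n)"
  by (induction n) (auto simp: linear_iff)

lemma norm_funpow_le:
  fixes T :: "'a::real_normed_vector \<Rightarrow> 'a"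
  assumes "\<And>x. norm (T x) \<le> K * norm x" "K \<ge> 0"
  shows "norm ((T ^^ n) x) \<le> K ^ n * norm x"
proof (induction n)
  case (Suc n)
  have "norm ((T ^^ Suc n) x) \<le> K * norm ((T ^^ n) x)" using assms(1) by simp
  also have "\<dots> \<le> K * (K ^ n * norm x)" using Suc assms(2) by (rule mult_left_mono)
  finally show ?case by (simp add: mult.assoc)
qed simp

text \<open>\<open>r z\<close> is the inverse of \<open>1 - z Q\<close>, the resolvent in the
  variable 1/mu. Spectrum {0} makes it available at every complex \<open>z\<close>; decay of powers
  is then extracted from its continuity.\<close>

locale entire_resolvent =
  fixes Q :: "'a::complex_banach \<Rightarrow> 'a" and r :: "complex \<Rightarrow> 'a \<Rightarrow> 'a"
  assumes Q: "bounded_clinear_op Q" and r: "bounded_clinear_op (r z)"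
    and left_inverse: "r z (x - z *\<^sub>C Q x) = x"
    and right_inverse: "r z x - z *\<^sub>C Q (r z x) = x"
begin

lemma linear_Q: "linear Q"
  using bounded_clinear_op_bounded_linear[OF Q] by (rule bounded_linear.linear)

lemma linear_r: "linear (r z)"
  using bounded_clinear_op_bounded_linear[OF r] by (rule bounded_linear.linear)

lemma Q_scaleC: "Q (a *\<^sub>C x) = a *\<^sub>C Q x" and r_scaleC: "r z (a *\<^sub>C x) = a *\<^sub>C r z x"
  using Q r unfolding bounded_clinear_op_def by blast+

lemma resolvent_identity: "r w x - r z x = (w - z) *\<^sub>C r z (Q (r w x))"
proof -
  define y where "y = r w x"
  have "x = (y - z *\<^sub>C Q y) - (w - z) *\<^sub>C Q y"
    using right_inverse[of w x] by (simp add: y_def scaleC_diff_left)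
  then have "r z x = r z ((y - z *\<^sub>C Q y) - (w - z) *\<^sub>C Q y)" by (rule arg_cong)
  also have "\<dots> = r z (y - z *\<^sub>C Q y) - r z ((w - z) *\<^sub>C Q y)" by (rule linear_diff[OF linear_r])
  also have "\<dots> = y - (w - z) *\<^sub>C r z (Q y)" by (simp only: left_inverse r_scaleC)
  finally show ?thesis by (simp add: y_def)
qed

lemma r_commute: "r z ((Q ^^ n) x) = (Q ^^ n) (r z x)"
proof (induction n)
  case (Suc n)
  have "r z (Q y) = Q (r z y)" for y
  proof -
    have "Q y = Q (r z y) - z *\<^sub>C Q (Q (r z y))"
      using right_inverse[of z y] by (metis Q_scaleC linear_diff linear_Q)
    then show ?thesis using left_inverse by metis
  qed
  then show ?case using Suc by simp
qed simp

text \<open>Continuity is taken in operator norm, through \<open>Blinfun\<close>, so that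
  compactness of a disc yields a modulus of continuity uniform in the vector.\<close>

lemma resolvent_continuous: "continuous_on A (\<lambda>z. Blinfun (r z))"
proof (intro continuous_at_imp_continuous_on ballI)
  fix z
  have bl: "bounded_linear (r w)" for w by (rule bounded_clinear_op_bounded_linear[OF r])
  obtain k where k: "k > 0" "\<And>x. norm (r z x) \<le> norm x * k"
    using bounded_linear.pos_bounded[OF bl] by blast
  obtain q where q: "q > 0" "\<And>x. norm (Q x) \<le> norm x * q"
    using bounded_linear.pos_bounded[OF bounded_clinear_op_bounded_linear[OF Q]] by blast
  have rQ: "norm (r z (Q y)) \<le> k * q * norm y" for y
  proof -
    have "norm (r z (Q y)) \<le> norm (Q y) * k" by (rule k)
    also have "\<dots> \<le> (norm y * q) * k" using q k by (intro mult_right_mono) auto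
    finally show ?thesis by (simp add: mult_ac)
  qed
  have "\<exists>d>0. \<forall>w. dist w z < d \<longrightarrow> dist (Blinfun (r w)) (Blinfun (r z)) < e" if "e > 0" for e
  proof (intro exI conjI allI impI)
    \<comment> \<open>The first bound absorbs the unknown norm of \<open>r w x\<close>, giving
      \<open>2 * k * norm x\<close>; the second then makes the difference at most
      \<open>e / 2 * norm x\<close>.\<close>
    let ?d = "min (1 / (2 * k * q)) (e / (4 * k * k * q))"
    show "?d > 0" using that k q by simp
    fix w assume w: "dist w z < ?d"
    then have w1: "cmod (w - z) * (k * q) \<le> 1 / 2" and w2: "cmod (w - z) * (k * q) * (2 * k) \<le> e / 2"
      using k q by (auto simp: dist_norm field_simps)
    have diff: "norm (r w x - r z x) \<le> cmod (w - z) * (k * q) * norm (r w x)" for x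
      using mult_left_mono[OF rQ[of "r w x"], of "cmod (w - z)"]
      unfolding resolvent_identity[of w x z] norm_scaleC by (simp add: mult_ac)
    have "norm (r w x) \<le> 2 * k * norm x" for x
    proof -
      have "norm (r w x) \<le> norm (r z x) + norm (r w x - r z x)" by (metis norm_triangle_sub)
      also have "\<dots> \<le> k * norm x + 1 / 2 * norm (r w x)"
        using k(2)[of x] diff[of x] mult_right_mono[OF w1, of "norm (r w x)"]
        by (simp add: mult_ac)
      finally show ?thesis by simp
    qed
    then have "norm (r w x - r z x) \<le> e / 2 * norm x" for x
    proof -
      assume a: "\<And>x. norm (r w x) \<le> 2 * k * norm x"
      have "norm (r w x - r z x) \<le> cmod (w - z) * (k * q) * (2 * k * norm x)"
        using order_trans[OF diff mult_left_mono[OF a]] k q by simp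
      then show ?thesis using mult_right_mono[OF w2, of "norm x"] by (simp add: mult_ac)
    qed
    then have "norm (Blinfun (r w) - Blinfun (r z)) \<le> e / 2"
      using that by (intro norm_blinfun_bound) (auto simp: blinfun.diff_left bounded_linear_Blinfun_apply bl)
    then show "dist (Blinfun (r w)) (Blinfun (r z)) < e" using that by (simp add: dist_norm)
  qed
  then show "isCont (\<lambda>z. Blinfun (r z)) z" by (simp add: continuous_at_eps_delta)
qed

lemma resolvent_uniformly_continuous:
  assumes "\<epsilon> > 0"
  obtains h where "h > 0"
    "\<And>z w x. cmod z \<le> R \<Longrightarrow> cmod w \<le> R \<Longrightarrow> cmod (z - w) < h \<Longrightarrow> norm (r z x - r w x) \<le> \<epsilon> * norm x"
proof -
  have "uniformly_continuous_on (cball 0 R) (\<lambda>z. Blinfun (r z))"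
    by (rule compact_uniformly_continuous[OF resolvent_continuous compact_cball])
  then obtain h where h: "h > 0"
    "\<And>z w. z \<in> cball 0 R \<Longrightarrow> w \<in> cball 0 R \<Longrightarrow> dist w z < h \<Longrightarrow> dist (Blinfun (r w)) (Blinfun (r z)) < \<epsilon>"
    unfolding uniformly_continuous_on_def using assms by metis
  show ?thesis
  proof (rule that[OF h(1)])
    fix z w x assume "cmod z \<le> R" "cmod w \<le> R" "cmod (z - w) < h"
    then have "norm (Blinfun (r z) - Blinfun (r w)) < \<epsilon>" using h(2)[of w z] by (simp add: dist_norm)
    then have "norm (blinfun_apply (Blinfun (r z) - Blinfun (r w)) x) \<le> \<epsilon> * norm x"
      by (meson less_imp_le mult_right_mono norm_blinfun norm_ge_zero order_trans)
    then show "norm (r z x - r w x) \<le> \<epsilon> * norm x"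
      by (simp add: blinfun.diff_left bounded_linear_Blinfun_apply bounded_clinear_op_bounded_linear[OF r])
  qed
qed

text \<open>The finite geometric series, valid at every \<open>w\<close> without any smallness.
  Points \<open>w\<close> with the same \<open>n\<close>-th power share the argument on the left, so
  their resolvents can be averaged.\<close>

lemma resolvent_partial_sum: "r w (x - w ^ n *\<^sub>C (Q ^^ n) x) = (\<Sum>k<n. w ^ k *\<^sub>C (Q ^^ k) x)"
proof (induction n)
  case 0
  then show ?case by (simp add: scaleC_one linear_0[OF linear_r])
next
  case (Suc n)
  define y where "y = w ^ n *\<^sub>C (Q ^^ n) x"
  have "w ^ Suc n *\<^sub>C (Q ^^ Suc n) x = w *\<^sub>C Q y"
    by (simp add: y_def Q_scaleC scaleC_scaleC)
  then have "x - w ^ Suc n *\<^sub>C (Q ^^ Suc n) x = (x - y) + (y - w *\<^sub>C Q y)" by simp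
  then have "r w (x - w ^ Suc n *\<^sub>C (Q ^^ Suc n) x) = r w (x - y) + y"
    by (simp only: linear_add[OF linear_r] left_inverse)
  then show ?case using Suc by (simp add: y_def)
qed

definition unit_root :: "nat \<Rightarrow> complex" where
  "unit_root n = exp (2 * of_real pi * \<i> / of_nat n)"

lemma unit_root_power: "unit_root n ^ k = exp (2 * of_real pi * \<i> * of_nat k / of_nat n)"
  unfolding unit_root_def by (simp flip: exp_of_nat_mult add: mult_ac)

lemma unit_root_power_order: "n > 0 \<Longrightarrow> (unit_root n ^ j) ^ n = 1"
  unfolding power_mult[symmetric] by (subst unit_root_power, subst complex_root_unity_eq_1) auto

lemma sum_root_powers:
  assumes "k < n"
  shows "(\<Sum>j<n. (unit_root n ^ j) ^ k) = (if k = 0 then of_nat n else 0)"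
proof (cases "k = 0")
  case False
  have "unit_root n ^ k \<noteq> 1"
    using assms False complex_root_unity_eq_1[of n k] by (auto simp: unit_root_power dest: dvd_imp_le)
  moreover have "(unit_root n ^ k) ^ n = 1" using assms by (intro unit_root_power_order) auto
  ultimately have "(\<Sum>j<n. (unit_root n ^ k) ^ j) = 0" by (simp add: geometric_sum)
  moreover have "(unit_root n ^ j) ^ k = (unit_root n ^ k) ^ j" for j by (metis power_mult mult.commute)
  ultimately show ?thesis using False by simp
qed simp

text \<open>An \<open>n\<close>-point Riemann sum for the mean of the resolvent over the circle of
  radius \<open>t\<close>.\<close>

definition avg :: "nat \<Rightarrow> real \<Rightarrow> 'a \<Rightarrow> 'a" where
  "avg n t x = (1 / real n) *\<^sub>R (\<Sum>j<n. r (of_real t * unit_root n ^ j) x)"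

text \<open>The sample points all have \<open>n\<close>-th power \<open>t ^ n\<close>; in the
  averaged geometric sums orthogonality of roots of unity kills every \<open>k\<close> except
  0.\<close>

lemma avg_left_inverse:
  assumes "n > 0"
  shows "avg n t (x - of_real (t ^ n) *\<^sub>C (Q ^^ n) x) = x"
proof -
  have "r (of_real t * unit_root n ^ j) (x - of_real (t ^ n) *\<^sub>C (Q ^^ n) x)
      = (\<Sum>k<n. (of_real t * unit_root n ^ j) ^ k *\<^sub>C (Q ^^ k) x)" for j
    using resolvent_partial_sum[of "of_real t * unit_root n ^ j" x n] by (simp add: power_mult_distrib unit_root_power_order assms)
  then have "(\<Sum>j<n. r (of_real t * unit_root n ^ j) (x - of_real (t ^ n) *\<^sub>C (Q ^^ n) x))
      = (\<Sum>j<n. \<Sum>k<n. (of_real t * unit_root n ^ j) ^ k *\<^sub>C (Q ^^ k) x)" by simp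
  also have "\<dots> = (\<Sum>k<n. (\<Sum>j<n. (of_real t * unit_root n ^ j) ^ k) *\<^sub>C (Q ^^ k) x)"
    by (subst sum.swap) (simp add: scaleC_sum_left)
  also have "\<dots> = (\<Sum>k<n. if k = 0 then of_nat n *\<^sub>C x else 0)"
    by (intro sum.cong refl) (simp add: power_mult_distrib sum_root_powers flip: sum_distrib_left)
  also have "\<dots> = real n *\<^sub>R x"
    using assms by (simp flip: scaleC_of_real)
  finally show ?thesis using assms by (simp add: avg_def)
qed

lemma linear_avg: "linear (avg n t)"
  unfolding avg_def[abs_def]
  by (rule linearI) (simp_all add: linear_add[OF linear_r] linear_cmul[OF linear_r] sum.distrib
      algebra_simps scaleR_sum_right[symmetric])

lemma avg_right_inverse:
  assumes "n > 0"
  shows "avg n t x - of_real (t ^ n) *\<^sub>C (Q ^^ n) (avg n t x) = x"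
proof -
  have l: "linear (\<lambda>y. of_real (t ^ n) *\<^sub>C (Q ^^ n) y)"
    using linear_compose[OF linear_funpow[OF linear_Q] linear_scaleC] by (simp add: o_def)
  have "avg n t (of_real (t ^ n) *\<^sub>C (Q ^^ n) x) = of_real (t ^ n) *\<^sub>C (Q ^^ n) (avg n t x)"
    unfolding avg_def r_scaleC r_commute linear_cmul[OF l] linear_sum[OF l] ..
  then show ?thesis using avg_left_inverse[OF assms, of t x] by (simp add: linear_diff[OF linear_avg])
qed

text \<open>Averaging \<open>r\<close> over the \<open>n\<close>-th roots of unity gives \<open>(1 - t\<^sup>n Q\<^sup>n)\<^sup>-\<^sup>1\<close>, and the
averages inherit the modulus of continuity of \<open>r\<close> uniformly in \<open>n\<close>. So once \<open>t\<^sup>n Q\<^sup>n\<close> is small,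
\<open>t' ^ n Q\<^sup>n\<close> stays bounded for \<open>t'\<close> slightly larger, by an amount independent of \<open>t\<close> and \<open>n\<close>.\<close>

lemma power_bound_step:
  assumes n: "n > 0" and t: "0 \<le> t" "t \<le> t'"
    and small: "\<And>x. t ^ n * norm ((Q ^^ n) x) \<le> 1 / 8 * norm x"
    and close: "\<And>z w x. cmod z \<le> t' \<Longrightarrow> cmod w \<le> t' \<Longrightarrow> cmod (z - w) \<le> t' - t \<Longrightarrow>
        norm (r z x - r w x) \<le> 1 / 2 * norm x"
  shows "t' ^ n * norm ((Q ^^ n) x) \<le> 3 * norm x"
proof -
  have 1: "norm (avg n t x - x) \<le> 1 / 4 * norm x" for x
  proof -
    define y where "y = avg n t x"
    have "y - x = of_real (t ^ n) *\<^sub>C (Q ^^ n) y"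
      using avg_right_inverse[OF n, of t x] by (simp add: y_def algebra_simps)
    then have "norm (y - x) \<le> 1 / 8 * norm y"
      using small[of y] t by (simp add: norm_scaleC norm_power)
    moreover have "norm y \<le> norm x + norm (y - x)" by (metis norm_triangle_sub)
    ultimately have "norm (y - x) \<le> 1 / 4 * norm x" using norm_ge_zero[of x] by linarith
    then show ?thesis by (simp add: y_def)
  qed
  have norm_unit_root: "cmod (unit_root n ^ j) = 1" for j by (simp add: unit_root_power)
  have 2: "norm (avg n t' x - avg n t x) \<le> 1 / 2 * norm x" for x
  proof -
    have "norm (r (of_real t' * unit_root n ^ j) x - r (of_real t * unit_root n ^ j) x) \<le> 1 / 2 * norm x" for j
    proof (rule close)
      have "of_real t' * unit_root n ^ j - of_real t * unit_root n ^ j = of_real (t' - t) * unit_root n ^ j"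
        by (simp add: algebra_simps)
      then show "cmod (of_real t' * unit_root n ^ j - of_real t * unit_root n ^ j) \<le> t' - t"
        using t by (simp add: norm_mult norm_unit_root del: of_real_diff)
    qed (use t in \<open>simp_all add: norm_mult norm_unit_root\<close>)
    then have "norm (\<Sum>j<n. r (of_real t' * unit_root n ^ j) x - r (of_real t * unit_root n ^ j) x)
        \<le> (\<Sum>j<n. 1 / 2 * norm x)" by (intro sum_norm_le)
    then have "norm (\<Sum>j<n. r (of_real t' * unit_root n ^ j) x - r (of_real t * unit_root n ^ j) x)
        \<le> n * (1 / 2 * norm x)" by simp
    then have "(1 / n) * norm (\<Sum>j<n. r (of_real t' * unit_root n ^ j) x - r (of_real t * unit_root n ^ j) x)
        \<le> 1 / 2 * norm x" using n by (simp add: field_simps)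
    then show ?thesis using n by (simp add: avg_def sum_subtractf flip: scaleR_diff_right)
  qed
  \<comment> \<open>The two estimates put \<open>avg n t'\<close> within 1/4 + 1/2 = 3/4 of the
    identity. Hence \<open>norm y \<le> 4 * norm x\<close>, and the final 3 is 3/4 times 4.\<close>
  define y where "y = x - of_real (t' ^ n) *\<^sub>C (Q ^^ n) x"
  have "avg n t' y = x" unfolding y_def by (rule avg_left_inverse[OF n])
  moreover have "norm (avg n t' y - y) \<le> norm (avg n t y - y) + norm (avg n t' y - avg n t y)"
    by (metis add.commute diff_add_cancel diff_diff_eq2 norm_triangle_ineq)
  ultimately have "norm (x - y) \<le> 3 / 4 * norm y" using 1[of y] 2[of y] by simp
  moreover have "norm y \<le> norm x + norm (x - y)" by (metis norm_minus_commute norm_triangle_sub)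
  moreover have "norm (x - y) = t' ^ n * norm ((Q ^^ n) x)"
    using t by (simp add: y_def norm_scaleC norm_power)
  ultimately show ?thesis by linarith
qed

text \<open>Continuation in the radius, starting from 0. The step \<open>h / 2\<close> comes from
  uniform continuity on the disc of radius \<open>t + 1\<close> and thus depends only on the target
  \<open>t\<close>, so finitely many steps suffice.\<close>

lemma powers_tendsto_0:
  assumes "t \<ge> 0" "\<eta> > 0"
  shows "\<exists>N. \<forall>n\<ge>N. \<forall>x. t ^ n * norm ((Q ^^ n) x) \<le> \<eta> * norm x"
proof -
  define P where "P t \<longleftrightarrow> (\<forall>\<eta>>0. \<exists>N. \<forall>n\<ge>N. \<forall>x. t ^ n * norm ((Q ^^ n) x) \<le> \<eta> * norm x)" for t
  obtain h0 where h0: "h0 > 0" "\<And>z w x. cmod z \<le> t + 1 \<Longrightarrow> cmod w \<le> t + 1 \<Longrightarrow> cmod (z - w) < h0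
      \<Longrightarrow> norm (r z x - r w x) \<le> 1 / 2 * norm x"
    using resolvent_uniformly_continuous[of "1 / 2" "t + 1"] by auto
  define h where "h = min (h0 / 2) 1"
  have h: "h > 0" "h \<le> 1" "h < h0" using h0(1) by (auto simp: h_def)
  have step: "P (s + h / 2)" if s: "P s" "0 \<le> s" "s \<le> t" for s
    unfolding P_def
  proof (intro allI impI)
    fix \<eta> :: real assume "\<eta> > 0"
    obtain N0 where N0: "\<And>n x. n \<ge> N0 \<Longrightarrow> s ^ n * norm ((Q ^^ n) x) \<le> 1 / 8 * norm x"
      using s(1) unfolding P_def by (metis zero_less_divide_1_iff zero_less_numeral)
    \<comment> \<open>At radius \<open>s + h\<close> the powers are only bounded, by 3; retreating
      to \<open>s + h / 2\<close> gains the factor \<open>q ^ n\<close>, which restores convergence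
      to 0 for the next step.\<close>
    define q where "q = (s + h / 2) / (s + h)"
    have q: "0 \<le> q" "q < 1" using s h by (auto simp: q_def)
    then have "(\<lambda>n. q ^ n) \<longlonglongrightarrow> 0" by (intro LIMSEQ_power_zero) auto
    then have "eventually (\<lambda>n. q ^ n < \<eta> / 3) sequentially"
      using \<open>\<eta> > 0\<close> by (intro order_tendstoD) auto
    then obtain N1 where N1: "\<And>n. n \<ge> N1 \<Longrightarrow> q ^ n < \<eta> / 3" unfolding eventually_sequentially by blast
    show "\<exists>N. \<forall>n\<ge>N. \<forall>x. (s + h / 2) ^ n * norm ((Q ^^ n) x) \<le> \<eta> * norm x"
    proof (intro exI allI impI)
      fix n x assume n: "n \<ge> max (max N0 N1) 1"
      have *: "(s + h) ^ n * norm ((Q ^^ n) x) \<le> 3 * norm x"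
      proof (rule power_bound_step[where t = s])
        fix z w x assume "cmod z \<le> s + h" "cmod w \<le> s + h" "cmod (z - w) \<le> s + h - s"
        then show "norm (r z x - r w x) \<le> 1 / 2 * norm x" using s h by (intro h0(2)) auto
      qed (use n s h N0 in auto)
      have "(s + h / 2) ^ n * norm ((Q ^^ n) x) = q ^ n * ((s + h) ^ n * norm ((Q ^^ n) x))"
        using s h by (simp add: q_def power_divide)
      also have "\<dots> \<le> q ^ n * (3 * norm x)" using * q by (intro mult_left_mono) auto
      also have "\<dots> \<le> \<eta> / 3 * (3 * norm x)" using N1[of n] n by (intro mult_right_mono) auto
      finally show "(s + h / 2) ^ n * norm ((Q ^^ n) x) \<le> \<eta> * norm x" by simp
    qed
  qed
  have P0: "P 0"
    unfolding P_def by (intro allI impI exI[of _ 1]) (auto simp: power_0_left)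
  have steps: "real k * (h / 2) \<le> t + h / 2 \<Longrightarrow> P (real k * (h / 2))" for k
  proof (induction k)
    case (Suc k)
    have *: "real (Suc k) * (h / 2) = real k * (h / 2) + h / 2" by (simp add: field_simps)
    have "P (real k * (h / 2) + h / 2)"
      by (rule step) (use * Suc h in auto)
    then show ?case by (simp only: *)
  qed (simp add: P0)
  define k where "k = nat \<lceil>t / (h / 2)\<rceil>"
  have k: "t \<le> real k * (h / 2)" "real k * (h / 2) \<le> t + h / 2"
  proof -
    have "t / (h / 2) \<ge> 0" using assms h by simp
    then have "t / (h / 2) \<le> real k" "real k \<le> t / (h / 2) + 1" unfolding k_def by linarith+
    then show "t \<le> real k * (h / 2)" "real k * (h / 2) \<le> t + h / 2" using h by (auto simp: field_simps)
  qed
  obtain N where N: "\<And>n x. n \<ge> N \<Longrightarrow> (real k * (h / 2)) ^ n * norm ((Q ^^ n) x) \<le> \<eta> * norm x"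
    using steps[OF k(2)] assms(2) unfolding P_def by blast
  have "t ^ n * norm ((Q ^^ n) x) \<le> \<eta> * norm x" if "n \<ge> N" for n x
    using N[OF that, of x] mult_right_mono[OF power_mono[OF k(1) assms(1), of n], of "norm ((Q ^^ n) x)"]
    by simp
  then show ?thesis by blast
qed

end

text \<open>For bounded linear \<open>u\<close> this says that the \<open>n\<close>-th root of the
  norm of \<open>u ^^ n\<close> tends to 0, i.e. spectral radius zero, as an explicit bound uniform
  in \<open>n\<close> and \<open>x\<close>.\<close>

definition quick_decay :: "('a::real_normed_vector \<Rightarrow> 'a) \<Rightarrow> bool" where
  "quick_decay u \<longleftrightarrow> (\<forall>\<epsilon>>0. \<exists>C>0. \<forall>n x. norm ((u ^^ n) x) \<le> C * \<epsilon> ^ n * norm x)"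

lemma quasinilpotent_imp_quick_decay:
  fixes Q :: "'a::complex_banach \<Rightarrow> 'a"
  assumes Q: "bounded_clinear_op Q" and qn: "quasinilpotent Q"
  shows "quick_decay Q"
proof -
  have "\<exists>S. bounded_clinear_op S \<and> (\<forall>x. S (x - z *\<^sub>C Q x) = x) \<and> (\<forall>x. S x - z *\<^sub>C Q (S x) = x)" for z
  proof (cases "z = 0")
    case True
    then show ?thesis by (intro exI[of _ "\<lambda>x. x"]) (auto simp: bounded_clinear_op_def intro!: exI[of _ 1])
  next
    case False
    then have "1 / z \<notin> op_spectrum Q" using qn by (simp add: quasinilpotent_def)
    then obtain S where S: "bounded_clinear_op S" "\<And>x. S (Q x - (1 / z) *\<^sub>C x) = x"
        "\<And>x. Q (S x) - (1 / z) *\<^sub>C S x = x" unfolding op_spectrum_def by blast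
    have lS: "linear S" by (rule bounded_linear.linear[OF bounded_clinear_op_bounded_linear[OF S(1)]])
    have Sc: "S (a *\<^sub>C x) = a *\<^sub>C S x" and Qc: "Q (a *\<^sub>C x) = a *\<^sub>C Q x" for a x
      using S(1) Q unfolding bounded_clinear_op_def by blast+
    \<comment> \<open>\<open>1 - z Q = - z (Q - 1 / z)\<close>, so its inverse is \<open>S\<close>
      scaled by \<open>- 1 / z\<close>.\<close>
    define R where "R x = S ((- 1 / z) *\<^sub>C x)" for x
    have "bounded_clinear_op R"
    proof -
      obtain K where K: "\<And>x. norm (S x) \<le> K * norm x" using S(1) unfolding bounded_clinear_op_def by blast
      have "norm (R x) \<le> (K * cmod (- 1 / z)) * norm x" for x
        using K[of "(- 1 / z) *\<^sub>C x"] by (simp add: R_def norm_scaleC mult.assoc)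
      then have "\<exists>K. \<forall>x. norm (R x) \<le> K * norm x" by blast
      then show ?thesis unfolding bounded_clinear_op_def
        by (simp add: R_def scaleC_add_right linear_add[OF lS] Sc scaleC_scaleC mult.commute)
    qed
    moreover have "R (x - z *\<^sub>C Q x) = x" for x
    proof -
      have "(- 1 / z) *\<^sub>C (x - z *\<^sub>C Q x) = Q x - (1 / z) *\<^sub>C x"
        using False by (simp add: scaleC_diff_right scaleC_scaleC scaleC_minus_left scaleC_one)
      then show ?thesis using S(2) by (simp add: R_def)
    qed
    moreover have "R x - z *\<^sub>C Q (R x) = x" for x
    proof -
      have "R x - z *\<^sub>C Q (R x) = Q (S x) - (1 / z) *\<^sub>C S x"
        using False linear_neg[OF bounded_linear.linear[OF bounded_clinear_op_bounded_linear[OF Q]]]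
        by (simp add: R_def Sc Qc scaleC_scaleC scaleC_minus_left scaleC_minus_right scaleC_one linear_neg[OF lS])
      then show ?thesis using S(3) by simp
    qed
    ultimately show ?thesis by blast
  qed
  then obtain r where r: "\<And>z. bounded_clinear_op (r z) \<and> (\<forall>x. r z (x - z *\<^sub>C Q x) = x)
      \<and> (\<forall>x. r z x - z *\<^sub>C Q (r z x) = x)" by metis
  then interpret entire_resolvent Q r by unfold_locales (use Q in auto)
  obtain K where K: "K > 0" "\<And>x. norm (Q x) \<le> K * norm x"
    using bounded_linear.pos_bounded[OF bounded_clinear_op_bounded_linear[OF Q]] by (metis mult.commute)
  show ?thesis unfolding quick_decay_def
  proof (intro allI impI)
    fix \<epsilon> :: real assume e: "\<epsilon> > 0"
    obtain N where N: "\<And>n x. n \<ge> N \<Longrightarrow> (1 / \<epsilon>) ^ n * norm ((Q ^^ n) x) \<le> 1 * norm x"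
      using powers_tendsto_0[of "1 / \<epsilon>" 1] e by auto
    \<comment> \<open>Radius \<open>1 / \<epsilon>\<close> settles all \<open>n \<ge> N\<close>; the
      sum covers the finitely many earlier powers by the crude bound \<open>K ^ n\<close>.\<close>
    define C where "C = 1 + (\<Sum>n<N. (K / \<epsilon>) ^ n)"
    have C: "C \<ge> 1" using K e by (simp add: C_def sum_nonneg)
    have "norm ((Q ^^ n) x) \<le> C * \<epsilon> ^ n * norm x" for n x
    proof (cases "n \<ge> N")
      case True
      then have "norm ((Q ^^ n) x) \<le> \<epsilon> ^ n * norm x" using N[OF True, of x] e by (simp add: field_simps)
      also have "\<dots> \<le> C * (\<epsilon> ^ n * norm x)" using C e mult_right_mono[of 1 C "\<epsilon> ^ n * norm x"] by simp
      finally show ?thesis by (simp add: mult.assoc)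
    next
      case False
      have "(K / \<epsilon>) ^ n \<le> (\<Sum>n<N. (K / \<epsilon>) ^ n)"
        using False K e by (intro member_le_sum) auto
      then have "(K / \<epsilon>) ^ n \<le> C" by (simp add: C_def)
      then have "K ^ n \<le> C * \<epsilon> ^ n" using e by (simp add: power_divide pos_divide_le_eq)
      then have "K ^ n * norm x \<le> C * \<epsilon> ^ n * norm x" by (rule mult_right_mono) simp
      then show ?thesis using norm_funpow_le[of Q K n x] K by simp
    qed
    then show "\<exists>C>0. \<forall>n x. norm ((Q ^^ n) x) \<le> C * \<epsilon> ^ n * norm x" using C by (intro exI[of _ C]) auto
  qed
qed

section \<open>Sign changes and forward differences\<close>

definition fdiff :: "(nat \<Rightarrow> real) \<Rightarrow> nat \<Rightarrow> real" where
  "fdiff g n = g (Suc n) - g n"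

lemma fdiff_funpow_Suc: "(fdiff ^^ Suc m) g t = (fdiff ^^ m) g (Suc t) - (fdiff ^^ m) g t"
  by (simp add: fdiff_def)

lemmas fdiff_simps = fdiff_funpow_Suc funpow_0

lemma fdiff_funpow_diff: "(fdiff ^^ m) (\<lambda>n. g n - h n) t = (fdiff ^^ m) g t - (fdiff ^^ m) h t"
  by (induction m arbitrary: t) (simp_all add: fdiff_simps del: funpow.simps)

lemma fdiff_funpow_cmult: "(fdiff ^^ m) (\<lambda>n. c * g n) t = c * (fdiff ^^ m) g t"
  by (induction m arbitrary: t) (simp_all add: fdiff_simps algebra_simps del: funpow.simps)

lemma fdiff_funpow_const: "m \<noteq> 0 \<Longrightarrow> (fdiff ^^ m) (\<lambda>_. c) t = 0"
proof (induction m arbitrary: t)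
  case (Suc m)
  then show ?case by (cases m) (simp_all add: fdiff_simps del: funpow.simps)
qed simp

lemma telescoping_sign:
  assumes "a < b" and "s * (g b - g a) \<ge> 0"
  obtains t where "a \<le> t" "t < b" "s * fdiff g t \<ge> 0"
proof -
  have "\<exists>t\<in>{a..<b}. s * fdiff g t \<ge> 0"
  proof (rule ccontr)
    assume "\<not> ?thesis"
    then have "(\<Sum>t=a..<b. s * fdiff g t) < (\<Sum>t=a..<b. 0)"
      using assms(1) by (intro sum_strict_mono) (auto simp: not_le)
    also have "(\<Sum>t=a..<b. s * fdiff g t) = s * (g b - g a)"
      using assms(1) unfolding fdiff_def sum_distrib_left[symmetric]
      by (subst sum_Suc_diff') auto
    finally show False using assms(2) by simp
  qed
  then show ?thesis using that by auto
qed

text \<open>From \<open>e i\<close> to \<open>e (Suc i)\<close> the sequence moves in the direction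
  \<open>- s * (-1) ^ i\<close>, hence so does a single step at some \<open>d i\<close>; the strict
  bound \<open>d i < e (Suc i)\<close> keeps the \<open>d i\<close> increasing for the induction.
  Weak signs matter: the function \<open>h\<close> to which this is applied vanishes at the first
  node.\<close>

lemma discrete_Rolle:
  assumes "\<And>i. i < m \<Longrightarrow> e i < e (Suc i)" and "\<And>i. i \<le> m \<Longrightarrow> s * (-1) ^ i * g (e i) \<ge> 0"
  shows "\<exists>t\<ge>e 0. t \<le> e m \<and> s * (-1) ^ m * (fdiff ^^ m) g t \<ge> 0"
  using assms
proof (induction m arbitrary: g e s)
  case 0
  then show ?case by auto
next
  case (Suc m)
  have "\<exists>t. e i \<le> t \<and> t < e (Suc i) \<and> (- s) * (-1) ^ i * fdiff g t \<ge> 0" if "i \<le> m" for i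
  proof (rule telescoping_sign[of "e i" "e (Suc i)" "(- s) * (-1) ^ i" g])
    show "e i < e (Suc i)" using Suc.prems(1) that by simp
    have "s * (-1) ^ Suc i * g (e (Suc i)) \<ge> 0" "s * (-1) ^ i * g (e i) \<ge> 0"
      using Suc.prems(2)[of "Suc i"] Suc.prems(2)[of i] that by auto
    then show "0 \<le> - s * (- 1) ^ i * (g (e (Suc i)) - g (e i))" by (simp add: algebra_simps)
  qed blast
  then obtain d where d: "\<And>i. i \<le> m \<Longrightarrow> e i \<le> d i \<and> d i < e (Suc i) \<and> (- s) * (-1) ^ i * fdiff g (d i) \<ge> 0"
    by metis
  have "d i < d (Suc i)" if "i < m" for i using d[of i] d[of "Suc i"] that by auto
  from Suc.IH[of d "- s" "fdiff g", OF this] d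
  obtain t where t: "d 0 \<le> t" "t \<le> d m" "(- s) * (-1) ^ m * (fdiff ^^ m) (fdiff g) t \<ge> 0" by auto
  have "(fdiff ^^ Suc m) g t = (fdiff ^^ m) (fdiff g) t" by (simp add: funpow_swap1)
  then have "s * (-1) ^ Suc m * (fdiff ^^ Suc m) g t \<ge> 0" using t(3) by simp
  moreover have "e 0 \<le> t" "t \<le> e (Suc m)" using t d[of 0] d[of m] by auto
  ultimately show ?case by blast
qed

text \<open>Leibniz rule for a linear factor, whose second difference vanishes.\<close>

lemma fdiff_linear_factor:
  "(fdiff ^^ Suc m) (\<lambda>n. (real n - b) * q n) t
    = (real t - b) * (fdiff ^^ Suc m) q t + real (Suc m) * (fdiff ^^ m) q (Suc t)"
proof (induction m arbitrary: t)
  case 0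
  show ?case by (simp add: fdiff_simps algebra_simps del: funpow.simps)
next
  case (Suc m)
  show ?case
    unfolding fdiff_funpow_Suc[of "Suc m"] Suc.IH
    by (simp add: fdiff_simps algebra_simps del: funpow.simps)
qed

lemma fdiff_prod:
  "finite J \<Longrightarrow> (fdiff ^^ card J) (\<lambda>n. \<Prod>j\<in>J. real n - b j) t = fact (card J)"
proof -
  assume "finite J"
  then have "\<forall>t. (fdiff ^^ card J) (\<lambda>n. \<Prod>j\<in>J. real n - b j) t = fact (card J)"
  proof (induction J rule: finite_induct)
    case (insert j J)
    let ?q = "\<lambda>n. \<Prod>j\<in>J. real n - b j"
    \<comment> \<open>By induction the previous difference is constant, so only the second Leibniz
      term survives.\<close>
    have "(fdiff ^^ Suc (card J)) ?q t = 0" for t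
      using insert.IH by (simp add: fdiff_funpow_Suc del: funpow.simps)
    then show ?case
      using insert by (simp del: funpow.simps add: fdiff_linear_factor)
  qed simp
  then show ?thesis by blast
qed

text \<open>A discrete form of the interpolation remainder: it converts sign alternation into size.
  For orbits the \<open>m\<close>-th difference is superexponentially small in \<open>m\<close>,
  which will rule out \<open>m\<close> alternations in a window of length proportional to
  \<open>m\<close>.\<close>

lemma alternating_imp_large_difference:
  assumes inc: "\<And>i. i < m \<Longrightarrow> e i < e (Suc i)"
    and alt: "\<And>i. i \<le> m \<Longrightarrow> (-1) ^ i * g (e i) \<ge> 0"
  shows "\<exists>t\<ge>e 0. t \<le> e m \<and> fact m * g (e 0) \<le> real (e m - e 0) ^ m * \<bar>(fdiff ^^ m) g t\<bar>"
proof -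
  have mono: "e i < e j" if "i < j" "j \<le> m" for i j
    using that
  proof (induction j)
    case (Suc j)
    then show ?case using inc[of j] by (cases "i = j") (auto intro: less_trans)
  qed simp
  define P where "P = (\<Prod>j\<in>{1..m}. real (e j) - real (e 0))"
  \<comment> \<open>Subtracting from \<open>g\<close> a polynomial of degree \<open>m\<close> that agrees with \<open>g\<close> at \<open>e 0\<close> and vanishes at
    the other nodes leaves weakly alternating signs.\<close>
  define c where "c = g (e 0) / P"
  define q where "q n = (\<Prod>j\<in>{1..m}. real n - real (e j))" for n
  define h where "h n = g n - (-1) ^ m * c * q n" for n
  have Ppos: "P > 0" unfolding P_def by (rule prod_pos) (use mono in auto)
  have Ple: "P \<le> real (e m - e 0) ^ m"
  proof -
    have "P \<le> (\<Prod>j\<in>{1..m}. real (e m - e 0))" unfolding P_def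
    proof (rule prod_mono)
      fix j assume j: "j \<in> {1..m}"
      then have "e 0 < e j" "e j \<le> e m" using mono[of 0 j] mono[of j m] by (cases "j = m"; auto)+
      then show "0 \<le> real (e j) - real (e 0) \<and> real (e j) - real (e 0) \<le> real (e m - e 0)" by auto
    qed
    then show ?thesis by simp
  qed
  have q0: "q (e 0) = (-1) ^ m * P"
  proof -
    have "q (e 0) = (\<Prod>j\<in>{1..m}. (-1) * (real (e j) - real (e 0)))" unfolding q_def by simp
    then show ?thesis unfolding P_def prod.distrib by simp
  qed
  have "1 * (-1) ^ i * h (e i) \<ge> 0" if "i \<le> m" for i
  proof (cases "i = 0")
    case True
    have "(-1) ^ m * c * ((-1) ^ m * P) = c * P * ((-1) ^ m * (-1) ^ m)" by (simp only: mult_ac)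
    also have "\<dots> = g (e 0)" using Ppos by (simp add: c_def flip: power_add)
    finally show ?thesis using True by (simp add: h_def q0)
  next
    case False
    then have "q (e i) = 0" using that unfolding q_def by (intro prod_zero) auto
    then show ?thesis using alt[OF that] by (simp add: h_def)
  qed
  from discrete_Rolle[of m e 1 h, OF inc this] obtain t where t: "e 0 \<le> t" "t \<le> e m"
    and s: "(-1) ^ m * (fdiff ^^ m) h t \<ge> 0" by auto
  have "(fdiff ^^ m) h t = (fdiff ^^ m) g t - (-1) ^ m * c * fact m"
    unfolding h_def fdiff_funpow_diff fdiff_funpow_cmult
    using fdiff_prod[of "{1..m}" "\<lambda>j. real (e j)" t] by (simp add: q_def[abs_def])
  then have "(-1) ^ m * (fdiff ^^ m) g t - ((-1) ^ m * (-1) ^ m) * (c * fact m) \<ge> 0"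
    using s by (simp only: right_diff_distrib mult_ac)
  then have "c * fact m \<le> (-1) ^ m * (fdiff ^^ m) g t" by (simp flip: power_add)
  also have "\<dots> \<le> \<bar>(-1) ^ m * (fdiff ^^ m) g t\<bar>" by simp
  also have "\<dots> = \<bar>(fdiff ^^ m) g t\<bar>" by (simp add: abs_mult power_abs)
  finally have "fact m * g (e 0) \<le> P * \<bar>(fdiff ^^ m) g t\<bar>"
    using Ppos by (simp add: c_def field_simps)
  also have "\<dots> \<le> real (e m - e 0) ^ m * \<bar>(fdiff ^^ m) g t\<bar>"
    using Ple by (intro mult_right_mono) auto
  finally show ?thesis using t by blast
qed

section \<open>Bounded orbits\<close>

lemma quick_decay_compose:
  assumes a: "quick_decay a" and b: "\<And>x. norm (b x) \<le> K * norm x" "K \<ge> 0"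
    and comm: "\<And>x. a (b x) = b (a x)"
  shows "quick_decay (\<lambda>x. a (b x))"
  unfolding quick_decay_def
proof (intro allI impI)
  fix \<epsilon> :: real assume "\<epsilon> > 0"
  \<comment> \<open>Commutation gives \<open>(a b)^n = a^n b^n\<close>, so the rate for
    \<open>a\<close> must absorb the growth \<open>K ^ n\<close>; \<open>K + 1\<close> keeps the
    quotient meaningful at \<open>K = 0\<close>.\<close>
  then have e: "\<epsilon> / (K + 1) > 0" using b(2) by simp
  then obtain C where C: "C > 0" "\<And>n x. norm ((a ^^ n) x) \<le> C * (\<epsilon> / (K + 1)) ^ n * norm x"
    using a unfolding quick_decay_def by blast
  have ab: "(a ^^ n) (b x) = b ((a ^^ n) x)" for n x by (induction n) (simp_all add: comm)
  have pow: "((\<lambda>x. a (b x)) ^^ n) x = (a ^^ n) ((b ^^ n) x)" for n x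
    by (induction n) (simp_all add: ab)
  have "norm (((\<lambda>x. a (b x)) ^^ n) x) \<le> C * \<epsilon> ^ n * norm x" for n x
  proof -
    have "norm ((b ^^ n) x) \<le> (K + 1) ^ n * norm x"
      by (rule norm_funpow_le) (use b in \<open>auto simp: algebra_simps intro: add_increasing\<close>)
    then have "C * (\<epsilon> / (K + 1)) ^ n * norm ((b ^^ n) x) \<le> C * (\<epsilon> / (K + 1)) ^ n * ((K + 1) ^ n * norm x)"
      using C e by (intro mult_left_mono) auto
    also have "\<dots> = C * \<epsilon> ^ n * norm x" using b(2) by (simp add: power_divide)
    finally show ?thesis using C(2)[of n "(b ^^ n) x"] by (simp add: pow)
  qed
  then show "\<exists>C>0. \<forall>n x. norm (((\<lambda>x. a (b x)) ^^ n) x) \<le> C * \<epsilon> ^ n * norm x" using C(1) by blast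
qed

lemma quick_decay_bounded:
  assumes "quick_decay u"
  obtains C where "C > 0" "\<And>n x. norm ((u ^^ n) x) \<le> C * norm x"
  using assms unfolding quick_decay_def by (metis mult.right_neutral power_one zero_less_one)

lemma quick_decay_bounded_op:
  assumes "quick_decay u"
  shows "\<exists>K. \<forall>x. norm (u x) \<le> K * norm x"
proof -
  obtain C where "C > 0" "\<And>n x. norm ((u ^^ n) x) \<le> C * norm x"
    using quick_decay_bounded[OF assms] by blast
  then have "norm ((u ^^ 1) x) \<le> C * norm x" for x by blast
  then show ?thesis by auto
qed

section \<open>The logistic polynomial of an operator and the halving of bounds\<close>

definition logistic :: "('a::real_vector \<Rightarrow> 'a) \<Rightarrow> 'a \<Rightarrow> 'a" where
  "logistic u x = 4 *\<^sub>R u x - 4 *\<^sub>R u (u x)"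

lemma linear_logistic: "linear u \<Longrightarrow> linear (logistic u)"
  unfolding logistic_def[abs_def] linear_iff by (simp add: algebra_simps)

lemma quick_decay_logistic:
  assumes u: "linear u" "quick_decay u"
  shows "quick_decay (logistic u)"
proof -
  obtain C where C: "C > 0" "\<And>n x. norm ((u ^^ n) x) \<le> C * norm x" using quick_decay_bounded[OF u(2)] by blast
  let ?b = "\<lambda>x. 4 *\<^sub>R x - 4 *\<^sub>R u x"
  have "norm (?b x) \<le> (4 + 4 * C) * norm x" for x
    using norm_triangle_ineq4[of "4 *\<^sub>R x" "4 *\<^sub>R u x"] C(2)[of 1 x] by (simp add: algebra_simps)
  moreover have "u (?b x) = ?b (u x)" for x
    by (simp add: linear_diff[OF u(1)] linear_cmul[OF u(1)])
  ultimately have "quick_decay (\<lambda>x. u (?b x))"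
    using C(1) by (intro quick_decay_compose[OF u(2), where K = "4 + 4 * C"]) auto
  moreover have "(\<lambda>x. u (?b x)) = logistic u"
    by (simp add: fun_eq_iff logistic_def linear_diff[OF u(1)] linear_cmul[OF u(1)])
  ultimately show ?thesis by simp
qed

text \<open>Maximum principle on the unbounded strip \<open>0 \<le> i \<le> N\<close>; adding the strictly concave perturbation \<open>w\<close>
avoids having to attain the supremum.\<close>

lemma discrete_subharmonic_bound:
  fixes d :: "nat \<Rightarrow> nat \<Rightarrow> real"
  assumes mid: "\<And>i j. Suc i < N \<Longrightarrow> i \<ge> 1 \<or> j \<ge> 1 \<Longrightarrow> d (Suc i) j \<le> (d i (Suc j) + d (Suc (Suc i)) j) / 2"
    and mid0: "\<And>j. 1 < N \<Longrightarrow> d 1 j \<le> (d 0 (Suc j) + d 2 j) / 2"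
    and left: "\<And>j. j \<ge> 1 \<Longrightarrow> d 0 j \<le> c" and right: "\<And>j. d N j \<le> c"
    and bound: "\<And>i j. i \<le> N \<Longrightarrow> d i j \<le> B"
    and i: "1 \<le> i" "i \<le> N"
  shows "d i j \<le> c"
proof (rule field_le_epsilon)
  fix e :: real assume "e > 0"
  \<comment> \<open>Chosen so that the perturbation, at most \<open>\<eta> * N * N\<close>, stays
    below \<open>e\<close>.\<close>
  define \<eta> where "\<eta> = e / (1 + real N * real N)"
  have "\<eta> > 0" using \<open>e > 0\<close> by (simp add: \<eta>_def add_pos_nonneg)
  define w where "w i = c + \<eta> * (real i * (real N - real i))" for i
  have conc: "(w i + w (Suc (Suc i))) / 2 = w (Suc i) - \<eta>" for i
    by (simp add: w_def field_simps)
  \<comment> \<open>Averaging \<open>w\<close> over the two neighbours loses \<open>\<eta>\<close>,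
    so each pass lowers the possible excess by \<open>\<eta>\<close> until it reaches 0. The corner
    (0, 0), where no boundary value is known, is never consulted: a move to \<open>i = 0\<close>
    raises \<open>j\<close>.\<close>
  have est: "\<forall>i j. i \<le> N \<longrightarrow> i \<ge> 1 \<or> j \<ge> 1 \<longrightarrow> d i j - w i \<le> max 0 (B - c - real k * \<eta>)" for k
  proof (induction k)
    case 0
    have "w i \<ge> c" if "i \<le> N" for i using that \<open>\<eta> > 0\<close> by (simp add: w_def)
    then show ?case using bound by (fastforce intro: max.coboundedI2 diff_mono)
  next
    case (Suc k)
    show ?case
    proof (intro allI impI)
      fix i j :: nat assume ij: "i \<le> N" "i \<ge> 1 \<or> j \<ge> 1"
      consider "i = 0" | "i = N" | i' where "i = Suc i'" "Suc i' < N"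
        using ij by (metis le_neq_implies_less not0_implies_Suc)
      then show "d i j - w i \<le> max 0 (B - c - real (Suc k) * \<eta>)"
      proof cases
        case 1
        then show ?thesis using left[of j] ij by (auto simp: w_def max_def)
      next
        case 2
        then show ?thesis using right[of j] by (auto simp: w_def max_def)
      next
        case 3
        have "d (Suc i') j \<le> (d i' (Suc j) + d (Suc (Suc i')) j) / 2"
          using mid[of i' j] mid0[of j] 3 by (cases "i' = 0") (auto simp: numeral_2_eq_2)
        moreover have "d i' (Suc j) - w i' \<le> max 0 (B - c - real k * \<eta>)"
          "d (Suc (Suc i')) j - w (Suc (Suc i')) \<le> max 0 (B - c - real k * \<eta>)"
          using Suc.IH 3 by auto
        ultimately have "d i j - w i \<le> max 0 (B - c - real k * \<eta>) - \<eta>"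
          using conc[of i'] 3(1) by simp
        then show ?thesis using \<open>\<eta> > 0\<close> by (auto simp: max_def algebra_simps split: if_splits)
      qed
    qed
  qed
  obtain k :: nat where "(B - c) / \<eta> \<le> real k" using real_arch_simple by blast
  then have "B - c - real k * \<eta> \<le> 0" using \<open>\<eta> > 0\<close> by (simp add: field_simps)
  then have "d i j \<le> w i" using est[of k] i by (auto simp: max_def split: if_splits)
  also have "\<dots> \<le> c + \<eta> * (real N * real N)"
    using i \<open>\<eta> > 0\<close> by (auto simp: w_def intro!: mult_left_mono mult_mono)
  also have "\<dots> \<le> c + e" using \<open>e > 0\<close>
    by (simp add: \<eta>_def pos_divide_le_eq add_pos_nonneg algebra_simps)
  finally show "d i j \<le> c + e" .
qed

text \<open>A maximum principle in the two exponents of \<open>u\<close> and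
  \<open>v = logistic u\<close>. The hypothesis bounds the edge \<open>i = 0\<close>, decay of
  \<open>u\<close> makes a far edge \<open>i = N\<close> negligible, and the gain
  \<open>2 ^ i\<close> is the weight that makes the values subharmonic.\<close>

lemma halving:
  fixes \<phi> :: "'a::real_normed_vector \<Rightarrow> real"
  assumes u: "linear u" "quick_decay u"
    and \<phi>: "linear \<phi>" "\<And>x. \<bar>\<phi> x\<bar> \<le> norm x"
    and C: "\<And>j. j \<ge> 1 \<Longrightarrow> \<bar>\<phi> ((logistic u ^^ j) x)\<bar> \<le> C"
    and i: "i \<ge> 1"
  shows "\<bar>\<phi> ((u ^^ i) x)\<bar> \<le> C / 2 ^ i"
proof -
  define v where "v = logistic u"
  have lv: "linear (v ^^ j)" for j unfolding v_def by (rule linear_funpow[OF linear_logistic[OF u(1)]])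
  obtain B where B: "B > 0" "\<And>n x. norm ((v ^^ n) x) \<le> B * norm x"
    using quick_decay_bounded[OF quick_decay_logistic[OF u]] unfolding v_def by blast
  \<comment> \<open>The rate 1/4 leaves (1/2)^i after multiplication by the weight 2^i.\<close>
  obtain D where D: "D > 0" "\<And>n x. norm ((u ^^ n) x) \<le> D * (1 / 4) ^ n * norm x"
    using u(2) unfolding quick_decay_def by (metis zero_less_divide_1_iff zero_less_numeral)
  \<comment> \<open>With \<open>v = 4u(1 - u)\<close> one has \<open>u ^ (i + 1) = u ^ i v / 4 + u ^ (i + 2)\<close>; the weight \<open>2 ^ i\<close>
    turns the coefficients \<open>1/4, 1\<close> into \<open>1/2, 1/2\<close>.\<close>
  define d where "d i j = 2 ^ i * \<bar>\<phi> ((v ^^ j) ((u ^^ i) x))\<bar>" for i j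
  have rec: "d (Suc i) j \<le> (d i (Suc j) + d (Suc (Suc i)) j) / 2" for i j
  proof -
    define y where "y = (u ^^ i) x"
    have "u y = (1 / 4) *\<^sub>R v y + u (u y)" by (simp add: v_def logistic_def algebra_simps)
    then have "(v ^^ j) (u y) = (1 / 4) *\<^sub>R (v ^^ Suc j) y + (v ^^ j) (u (u y))"
      by (metis comp_apply funpow_Suc_right linear_add linear_cmul lv)
    then have "\<phi> ((v ^^ j) (u y)) = (1 / 4) * \<phi> ((v ^^ Suc j) y) + \<phi> ((v ^^ j) (u (u y)))"
      by (simp only: linear_add[OF \<phi>(1)] linear_cmul[OF \<phi>(1)] real_scaleR_def)
    then have "\<bar>\<phi> ((v ^^ j) (u y))\<bar> \<le> (1 / 4) * \<bar>\<phi> ((v ^^ Suc j) y)\<bar> + \<bar>\<phi> ((v ^^ j) (u (u y)))\<bar>"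
      by linarith
    then have "2 ^ i * \<bar>\<phi> ((v ^^ j) (u y))\<bar>
        \<le> 2 ^ i * ((1 / 4) * \<bar>\<phi> ((v ^^ Suc j) y)\<bar> + \<bar>\<phi> ((v ^^ j) (u (u y)))\<bar>)"
      by (rule mult_left_mono) simp
    then show ?thesis by (simp add: d_def y_def algebra_simps)
  qed
  have dB: "d i j \<le> B * D * norm x * (1 / 2) ^ i" for i j
  proof -
    have "\<bar>\<phi> ((v ^^ j) ((u ^^ i) x))\<bar> \<le> B * norm ((u ^^ i) x)"
      using \<phi>(2) B(2) order_trans by blast
    also have "\<dots> \<le> B * (D * (1 / 4) ^ i * norm x)"
      using B D by (intro mult_left_mono) auto
    finally have "d i j \<le> 2 ^ i * (B * (D * (1 / 4) ^ i * norm x))"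
      unfolding d_def by (rule mult_left_mono) simp
    also have "\<dots> = B * D * norm x * (2 * (1 / 4)) ^ i" by (simp only: power_mult_distrib mult_ac)
    finally show ?thesis by simp
  qed
  have "d i 0 \<le> C"
  proof (rule field_le_epsilon)
    fix e :: real assume "e > 0"
    have "(\<lambda>N. B * D * norm x * (1 / 2) ^ N) \<longlonglongrightarrow> B * D * norm x * 0"
      by (intro tendsto_mult tendsto_const LIMSEQ_power_zero) auto
    then have "eventually (\<lambda>N. B * D * norm x * (1 / 2) ^ N < e) sequentially"
      using \<open>e > 0\<close> by (intro order_tendstoD) auto
    then obtain N where N: "N \<ge> i" "B * D * norm x * (1 / 2) ^ N < e"
      unfolding eventually_sequentially by (meson nat_le_linear order_refl)
    have C0: "C \<ge> 0" using C[of 1] by simp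
    show "d i 0 \<le> C + e"
    proof (rule discrete_subharmonic_bound[where N = N and B = "B * D * norm x"])
      show "d 0 j \<le> C + e" if "j \<ge> 1" for j
        using C[OF that] \<open>e > 0\<close> by (simp add: d_def v_def)
      show "d N j \<le> C + e" for j using dB[of N j] N C0 by linarith
      show "d i j \<le> B * D * norm x" for i j
        by (rule order_trans[OF dB]) (use B D in \<open>simp add: mult_left_le power_le_one\<close>)
    qed (use rec N i in \<open>auto simp: numeral_2_eq_2\<close>)
  qed
  then show ?thesis by (simp add: d_def field_simps)
qed

lemma iterated_halving:
  fixes \<phi> :: "'a::real_normed_vector \<Rightarrow> real"
  assumes "linear u" "quick_decay u" and \<phi>: "linear \<phi>" "\<And>x. \<bar>\<phi> x\<bar> \<le> norm x"
    and "\<And>j. j \<ge> 1 \<Longrightarrow> \<bar>\<phi> ((((logistic ^^ p) u) ^^ j) x)\<bar> \<le> C" and "i \<ge> 1"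
  shows "\<bar>\<phi> ((u ^^ i) x)\<bar> \<le> C / 2 ^ p"
  using assms(1,2,5,6)
proof (induction p arbitrary: u i)
  case (Suc p)
  have C: "\<bar>\<phi> ((logistic u ^^ j) x)\<bar> \<le> C / 2 ^ p" if "j \<ge> 1" for j
    by (rule Suc.IH) (use Suc.prems that in \<open>auto simp: linear_logistic quick_decay_logistic funpow_swap1\<close>)
  have "\<bar>\<phi> ((u ^^ i) x)\<bar> \<le> (C / 2 ^ p) / 2 ^ i"
    by (rule halving[OF Suc.prems(1,2) \<phi> C Suc.prems(4)])
  also have "\<dots> \<le> (C / 2 ^ p) / 2 ^ 1"
    using C[of 1] Suc.prems(4) by (intro divide_left_mono power_increasing) auto
  finally show ?case by simp
qed simp

section \<open>Half-angle sines of an invertible operator\<close>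

locale inverse_pair =
  fixes S R :: "'a::real_normed_vector \<Rightarrow> 'a"
  assumes S: "linear S" and R: "linear R" and SR: "S (R x) = x" and RS: "R (S x) = x"
begin

lemma SR_funpow: "(S ^^ n) ((R ^^ n) x) = x" and RS_funpow: "(R ^^ n) ((S ^^ n) x) = x"
  by (induction n arbitrary: x) (simp_all add: funpow_swap1 SR RS)

text \<open>On \<open>S = e ^ (i \<theta>)\<close> this is \<open>sin\<^sup>2 (l \<theta> / 2)\<close>, whence the doubling formula \<open>logistic_sin2\<close>.\<close>

definition sin2 :: "nat \<Rightarrow> 'a \<Rightarrow> 'a" where
  "sin2 l x = (1 / 4) *\<^sub>R (2 *\<^sub>R x - (S ^^ l) x - (R ^^ l) x)"

lemma linear_sin2: "linear (sin2 l)"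
  unfolding sin2_def[abs_def] using linear_funpow[OF S, of l] linear_funpow[OF R, of l]
  by (simp add: linear_iff algebra_simps)

lemma logistic_sin2: "logistic (sin2 l) = sin2 (2 * l)"
proof
  fix x
  define s r where "s = S ^^ l" and "r = R ^^ l"
  have l: "linear s" "linear r" unfolding s_def r_def by (intro linear_funpow S R)+
  have sr: "s (r y) = y" "r (s y) = y" for y by (simp_all add: s_def r_def SR_funpow RS_funpow)
  have "(S ^^ (2 * l)) x = s (s x)" "(R ^^ (2 * l)) x = r (r x)"
    by (simp_all add: s_def r_def mult_2 funpow_add)
  then show "logistic (sin2 l) x = sin2 (2 * l) x"
    unfolding logistic_def sin2_def s_def[symmetric] r_def[symmetric]
    by (simp add: linear_diff[OF l(1)] linear_diff[OF l(2)] linear_add[OF l(1)] linear_add[OF l(2)]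
      linear_cmul[OF l(1)] linear_cmul[OF l(2)] sr
      algebra_simps scaleR_2 flip: scaleR_add_left)
qed

lemma logistic_funpow_sin2: "(logistic ^^ p) (sin2 1) = sin2 (2 ^ p)"
  by (induction p) (simp_all add: logistic_sin2)

text \<open>The coefficients 1/2, -1/4, -1/4 have absolute sum 1: each application widens the window
  by \<open>l\<close> on both sides and leaves the bound unchanged. \<open>k * l \<le> n\<close>
  keeps all times nonnegative.\<close>

lemma sin2_funpow_bound:
  fixes \<phi> :: "'a \<Rightarrow> real"
  assumes \<phi>: "linear \<phi>" and "k * l \<le> n"
    and "\<And>i. n \<le> i + k * l \<Longrightarrow> i \<le> n + k * l \<Longrightarrow> \<bar>\<phi> ((S ^^ i) w)\<bar> \<le> C"
  shows "\<bar>\<phi> ((sin2 l ^^ k) ((S ^^ n) w))\<bar> \<le> C"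
  using assms(2,3)
proof (induction k arbitrary: n)
  case (Suc k)
  obtain m where n: "n = m + l" using Suc.prems(1) by (metis add.commute le_add_diff_inverse le_add1 mult_Suc order_trans)
  let ?f = "\<lambda>i. \<phi> ((sin2 l ^^ k) ((S ^^ i) w))"
  have l: "linear (sin2 l ^^ k)" by (rule linear_funpow[OF linear_sin2])
  have "sin2 l ((S ^^ n) w) = (1 / 4) *\<^sub>R (2 *\<^sub>R (S ^^ n) w - (S ^^ (n + l)) w - (S ^^ m) w)"
  proof -
    have "(S ^^ l) ((S ^^ n) w) = (S ^^ (n + l)) w" by (simp add: funpow_add add.commute[of n l])
    moreover have "(R ^^ l) ((S ^^ n) w) = (S ^^ m) w"
      unfolding n by (simp add: funpow_add add.commute[of m l] RS_funpow)
    ultimately show ?thesis by (simp add: sin2_def)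
  qed
  then have "\<phi> ((sin2 l ^^ Suc k) ((S ^^ n) w)) = (1 / 4) * (2 * ?f n - ?f (n + l) - ?f m)"
    by (simp add: funpow_swap1 linear_diff[OF l] linear_cmul[OF l] linear_diff[OF \<phi>] linear_cmul[OF \<phi>])
  moreover have "\<bar>?f n\<bar> \<le> C" "\<bar>?f (n + l)\<bar> \<le> C" "\<bar>?f m\<bar> \<le> C"
    using Suc.prems n by (auto intro!: Suc.IH)
  ultimately show ?case by (simp add: abs_if split: if_splits)
qed simp

lemma quick_decay_sin2:
  assumes "quick_decay (\<lambda>x. S x - x)" and "\<And>x. norm (R x) \<le> K * norm x" "K \<ge> 0"
  shows "quick_decay (sin2 1)"
proof -
  obtain C where C: "C > 0" "\<And>n x. norm (((\<lambda>x. S x - x) ^^ n) x) \<le> C * norm x"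
    using quick_decay_bounded[OF assms(1)] by blast
  \<comment> \<open>\<open>sin2 1 = (S - 1) b\<close> with \<open>b = - (1/4) R (S - 1)\<close>, so
    decay is inherited from \<open>S - 1\<close>.\<close>
  let ?b = "\<lambda>x. (- 1 / 4) *\<^sub>R R (S x - x)"
  have "norm (?b x) \<le> (K * C) * norm x" for x
  proof -
    have "norm (R (S x - x)) \<le> K * norm (S x - x)" by (rule assms(2))
    also have "\<dots> \<le> K * (C * norm x)" using C(2)[of 1 x] assms(3) by (intro mult_left_mono) auto
    finally have "norm (R (S x - x)) \<le> K * (C * norm x)" .
    moreover have "norm (?b x) = 1 / 4 * norm (R (S x - x))" by simp
    ultimately show ?thesis using norm_ge_zero[of "R (S x - x)"] unfolding mult.assoc by linarith
  qed
  then have "quick_decay (\<lambda>x. S (?b x) - ?b x)"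
    using C(1) assms(3)
    by (intro quick_decay_compose[OF assms(1), where K = "K * C"])
      (auto simp: linear_diff[OF S] linear_diff[OF R] linear_cmul[OF S] SR RS algebra_simps
        linear_neg[OF S] linear_neg[OF R] linear_add[OF S] linear_add[OF R])
  moreover have "(\<lambda>x. S (?b x) - ?b x) = sin2 1"
    by (simp add: fun_eq_iff sin2_def linear_diff[OF S] linear_diff[OF R] linear_cmul[OF S] SR RS
        linear_neg[OF S] algebra_simps flip: scaleR_add_left)
  ultimately show ?thesis by simp
qed

end

section \<open>Return times at the centre of long bounded windows\<close>

lemma spaced_selection:
  fixes B :: "nat set"
  assumes "finite B" "Suc m * D \<le> card B" "D \<ge> 1"
  shows "\<exists>e. (\<forall>i\<le>m. e i \<in> B) \<and> (\<forall>i<m. e i + D \<le> e (Suc i))"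
  using assms(1,2)
proof (induction m arbitrary: B)
  case 0
  then have "B \<noteq> {}" using assms(3) by auto
  then obtain b where "b \<in> B" by blast
  then show ?case by (intro exI[of _ "\<lambda>_. b"]) auto
next
  case (Suc m)
  have "card B \<noteq> 0" using Suc.prems(2) assms(3) by (intro notI) simp
  then have "B \<noteq> {}" by auto
  define b where "b = Min B"
  have b: "b \<in> B" "\<And>x. x \<in> B \<Longrightarrow> b \<le> x"
    using \<open>B \<noteq> {}\<close> Suc.prems by (auto simp: b_def)
  \<comment> \<open>Greedy choice: taking the least element and discarding its block of length
    \<open>D\<close> costs at most \<open>D\<close> elements.\<close>
  have "card B - card {b..<b + D} \<le> card (B - {b..<b + D})" by (rule diff_card_le_card_Diff) simp
  then have "Suc m * D \<le> card (B - {b..<b + D})" using Suc.prems by simp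
  then obtain e where e: "\<And>i. i \<le> m \<Longrightarrow> e i \<in> B - {b..<b + D}" "\<And>i. i < m \<Longrightarrow> e i + D \<le> e (Suc i)"
    using Suc.IH[of "B - {b..<b + D}"] Suc.prems by auto
  have "b + D \<le> e 0" using e(1)[of 0] b(2)[of "e 0"] by auto
  moreover have "case_nat b e i \<in> B" if "i \<le> Suc m" for i
    using that b(1) e(1) by (cases i) auto
  moreover have "case_nat b e i + D \<le> case_nat b e (Suc i)" if "i < Suc m" for i
    using that e(2) \<open>b + D \<le> e 0\<close> by (cases i) auto
  ultimately show ?case by blast
qed

text \<open>A single term of the exponential series: m^m / m! is at most e^m.\<close>

lemma power_self_le_fact: "real m ^ m \<le> 3 ^ m * fact m"
proof -
  have s: "(\<lambda>n. real m ^ n /\<^sub>R fact n) sums exp (real m)" by (rule exp_converges)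
  have "(\<Sum>n\<in>{m}. real m ^ n /\<^sub>R fact n) \<le> (\<Sum>n. real m ^ n /\<^sub>R fact n)"
    by (rule sum_le_suminf) (use s in \<open>auto simp: sums_iff\<close>)
  then have "real m ^ m / fact m \<le> exp (real m)" using s by (simp add: sums_iff divide_inverse mult.commute)
  also have "\<dots> = exp 1 ^ m" by (simp flip: exp_of_nat_mult)
  also have "\<dots> \<le> 3 ^ m" by (intro power_mono exp_le) auto
  finally show ?thesis by (simp add: field_simps)
qed

lemma fdiff_funpow_orbit:
  assumes "linear \<psi>" "linear S"
  shows "(fdiff ^^ m) (\<lambda>n. \<psi> ((S ^^ n) y)) t = \<psi> (((\<lambda>x. S x - x) ^^ m) ((S ^^ t) y))"
proof (induction m arbitrary: t)
  case (Suc m)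
  define Q where "Q = (\<lambda>x. S x - x)"
  have "linear Q" unfolding Q_def using assms(2) by (simp add: linear_iff algebra_simps)
  then have l: "linear (Q ^^ m)" by (rule linear_funpow)
  have "(Q ^^ Suc m) ((S ^^ t) y) = (Q ^^ m) ((S ^^ Suc t) y) - (Q ^^ m) ((S ^^ t) y)"
  proof -
    have "(Q ^^ Suc m) ((S ^^ t) y) = (Q ^^ m) (Q ((S ^^ t) y))" by (simp add: funpow_swap1)
    also have "Q ((S ^^ t) y) = (S ^^ Suc t) y - (S ^^ t) y" by (simp add: Q_def)
    finally show ?thesis by (simp only: linear_diff[OF l])
  qed
  then show ?case
    unfolding fdiff_funpow_Suc Suc.IH Q_def by (simp add: linear_diff[OF assms(1)] del: funpow.simps)
qed simp

text \<open>Otherwise every late return has a time within \<open>L\<close> where some functional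
  exceeds \<open>2 * M\<close>, while at the return itself it is at most \<open>M\<close>.
  Pigeonhole selects one functional for many returns; its values cross the level
  \<open>2 * M\<close> too often for the size of its differences. Only upper bounds are claimed, so
  two-sided ones require \<open>F\<close> to contain negatives.\<close>

lemma bounded_orbit_near_return:
  fixes S :: "'a::real_normed_vector \<Rightarrow> 'a"
  assumes S: "linear S" "\<And>x. norm (S x) \<le> K * norm x" and K: "K \<ge> 1"
    and Q: "quick_decay (\<lambda>x. S x - x)"
    and F: "finite F" "F \<noteq> {}" "\<And>\<psi>. \<psi> \<in> F \<Longrightarrow> linear \<psi>" "\<And>\<psi> x. \<psi> \<in> F \<Longrightarrow> \<bar>\<psi> x\<bar> \<le> norm x"
    and M: "M > 0" "\<And>a. a \<in> A \<Longrightarrow> norm ((S ^^ a) y) \<le> M"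
    and \<delta>: "\<delta> > 0" "\<And>n. n \<ge> n0 \<Longrightarrow> \<exists>k. card (A \<inter> {k..k + n}) \<ge> \<delta> * real n"
  shows "\<exists>a\<in>A. L \<le> a \<and> (\<forall>j \<psi>. a \<le> j + L \<longrightarrow> j \<le> a + L \<longrightarrow> \<psi> \<in> F \<longrightarrow> \<psi> ((S ^^ j) y) \<le> 2 * M)"
proof (rule ccontr)
  assume "\<not> ?thesis"
  then have "\<forall>a\<in>A. L \<le> a \<longrightarrow> (\<exists>\<psi>\<in>F. \<exists>j. a \<le> j + L \<and> j \<le> a + L \<and> \<psi> ((S ^^ j) y) > 2 * M)"
    by (meson not_le)
  then obtain J \<Psi> where J: "\<And>a. a \<in> A \<Longrightarrow> L \<le> a \<Longrightarrow> \<Psi> a \<in> F \<and> a \<le> J a + L \<and> J a \<le> a + L \<and> \<Psi> a ((S ^^ J a) y) > 2 * M"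
    by metis
  \<comment> \<open>With this spacing the intervals of radius \<open>L\<close> about the selected
    returns are disjoint, so nodes displaced by up to \<open>L\<close> remain increasing.\<close>
  define D where "D = 2 * L + 1"
  \<comment> \<open>A window of length \<open>H * m\<close> must retain
    \<open>card F * D * (m + 1)\<close> returns after the fewer than \<open>L + 1\<close> early ones
    are dropped; the factor 2 comes from \<open>m + 1 \<le> 2 * m\<close>.\<close>
  obtain H0 :: nat where H0: "(real L + 2 * card F * D) / \<delta> \<le> real H0" using real_arch_simple by blast
  define H where "H = H0 + 1"
  have H: "real L + 2 * card F * D \<le> \<delta> * H"
    using H0 \<delta>(1) by (simp add: H_def field_simps)
  \<comment> \<open>The last node may be displaced to the right by \<open>L\<close>, which is at
    most \<open>L * m\<close>.\<close>
  define H' where "H' = H + L"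
  have H': "H' \<ge> 1" by (simp add: H'_def H_def)
  \<comment> \<open>Chosen so that \<open>H' * \<epsilon> * K ^ H' = 1/6\<close>, which beats \<open>m ^ m \<le> 3 ^ m * fact m\<close>.\<close>
  define \<epsilon> where "\<epsilon> = 1 / (6 * H' * K ^ H')"
  have \<epsilon>: "\<epsilon> > 0" using H' K by (simp add: \<epsilon>_def)
  obtain C where C: "C > 0" "\<And>n x. norm (((\<lambda>x. S x - x) ^^ n) x) \<le> C * \<epsilon> ^ n * norm x"
    using Q \<epsilon> unfolding quick_decay_def by blast
  obtain m0 where m0: "C < 2 ^ m0" using real_arch_pow[of 2 C] by auto
  define m where "m = max (max 1 n0) m0"
  have m: "m \<ge> 1" "m \<ge> n0" "m \<ge> m0" by (auto simp: m_def)
  have Cm: "C < 2 ^ m" using m0 power_increasing[OF m(3), of "2::real"] by linarith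
  have "H * m \<ge> n0" using m by (simp add: H_def)
  then obtain k where k: "card (A \<inter> {k..k + H * m}) \<ge> \<delta> * real (H * m)" using \<delta>(2) by blast
  define B where "B = A \<inter> {k..k + H * m} - {..<L}"
  have finB: "finite B" by (simp add: B_def)
  have "card (A \<inter> {k..k + H * m}) - card {..<L} \<le> card B"
    unfolding B_def by (rule diff_card_le_card_Diff) simp
  then have "real (card B) \<ge> \<delta> * real (H * m) - L" using k by simp
  moreover have "\<delta> * real (H * m) \<ge> (real L + 2 * card F * D) * m"
    using mult_right_mono[OF H, of "real m"] by (simp add: mult.assoc)
  moreover have "real L * m \<ge> L" using m(1) mult_left_mono[of 1 "real m" "real L"] by simp
  moreover have "real (card F * D) * (2 * m) \<ge> real (card F * D) * (m + 1)"
    using m(1) by (intro mult_left_mono) auto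
  ultimately have "real (card B) \<ge> real (card F * D) * (m + 1)" by (simp add: algebra_simps)
  then have cardB: "card F * (Suc m * D) \<le> card B"
    by (metis (no_types, lifting) Suc_eq_plus1 mult.assoc mult.commute of_nat_le_iff of_nat_mult)
  have JB: "\<Psi> a \<in> F \<and> a \<le> J a + L \<and> J a \<le> a + L \<and> \<Psi> a ((S ^^ J a) y) > 2 * M" if "a \<in> B" for a
    using J[of a] that by (auto simp: B_def)
  have "\<exists>\<psi>\<in>F. Suc m * D \<le> card {a \<in> B. \<Psi> a = \<psi>}"
  proof (rule ccontr)
    assume "\<not> ?thesis"
    then have "(\<Sum>\<psi>\<in>F. card {a \<in> B. \<Psi> a = \<psi>}) < (\<Sum>\<psi>\<in>F. Suc m * D)"
      using F by (intro sum_strict_mono) (auto simp: not_le)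
    moreover have "card B \<le> (\<Sum>\<psi>\<in>F. card {a \<in> B. \<Psi> a = \<psi>})"
    proof -
      have "B = (\<Union>\<psi>\<in>F. {a \<in> B. \<Psi> a = \<psi>})" using JB by blast
      then show ?thesis using card_UN_le[OF F(1), of "\<lambda>\<psi>. {a \<in> B. \<Psi> a = \<psi>}"] by simp
    qed
    ultimately show False using cardB by simp
  qed
  then obtain \<psi> where \<psi>: "\<psi> \<in> F" "Suc m * D \<le> card {a \<in> B. \<Psi> a = \<psi>}" by blast
  then obtain e where e: "\<And>i. i \<le> m \<Longrightarrow> e i \<in> B \<and> \<Psi> (e i) = \<psi>" "\<And>i. i < m \<Longrightarrow> e i + D \<le> e (Suc i)"
    using spaced_selection[of "{a \<in> B. \<Psi> a = \<psi>}" m D] finB by (auto simp: D_def)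
  \<comment> \<open>Near each return \<open>\<psi>\<close> exceeds \<open>2 * M\<close> somewhere, so \<open>g\<close> below alternates in sign along \<open>e'\<close>, with
    a number of sign changes proportional to the length of the window.\<close>
  define e' where "e' i = (if even i then e i else J (e i))" for i
  have e'e: "e i \<le> e' i + L" "e' i \<le> e i + L" if "i \<le> m" for i
    using JB[of "e i"] e(1)[OF that] by (auto simp: e'_def)
  define g where "g n = 2 * M - \<psi> ((S ^^ n) y)" for n
  have psi_le: "\<bar>\<psi> ((S ^^ e i) y)\<bar> \<le> M" if "i \<le> m" for i
    using F(4)[OF \<psi>(1)] M(2)[of "e i"] e(1)[OF that] by (auto simp: B_def intro: order_trans)
  have inc: "e' i < e' (Suc i)" if "i < m" for i
    using e'e[of i] e'e[of "Suc i"] e(2)[OF that] that by (simp add: D_def)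
  have alt: "(-1) ^ i * g (e' i) \<ge> 0" if "i \<le> m" for i
    using psi_le[OF that] JB[of "e i"] e(1)[OF that] M(1) by (cases "even i") (auto simp: g_def e'_def)
  obtain t where t: "e' 0 \<le> t" "t \<le> e' m"
    "fact m * g (e' 0) \<le> real (e' m - e' 0) ^ m * \<bar>(fdiff ^^ m) g t\<bar>"
    using alternating_imp_large_difference[of m e' g, OF inc alt] by blast
  have span: "e' m - e' 0 \<le> H' * m"
  proof -
    have "e m \<le> k + H * m" "k \<le> e 0" using e(1)[of m] e(1)[of 0] by (auto simp: B_def)
    moreover have "L \<le> L * m" using m by simp
    moreover have "H' * m = H * m + L * m" "e' 0 = e 0" "e' m \<le> e m + L"
      using e'e(2)[of m] by (auto simp: H'_def e'_def algebra_simps)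
    ultimately show ?thesis by linarith
  qed
  \<comment> \<open>The orbit is restarted at the first selected return, where its norm is at most
    \<open>M\<close>. Growth is then governed by the window length and not by the uncontrolled
    position \<open>k\<close>.\<close>
  define x where "x = (S ^^ e 0) y"
  have x: "norm x \<le> M" using e(1)[of 0] M(2)[of "e 0"] by (auto simp: x_def B_def)
  have Sx: "norm ((S ^^ (t - e 0)) x) \<le> K ^ (H' * m) * M"
  proof -
    have "norm ((S ^^ (t - e 0)) x) \<le> K ^ (t - e 0) * norm x"
      by (rule norm_funpow_le) (use S K in auto)
    also have "\<dots> \<le> K ^ (H' * m) * M"
      using span t K x by (intro mult_mono power_increasing) (auto simp: e'_def)
    finally show ?thesis .
  qed
  have "(fdiff ^^ m) g t = - \<psi> (((\<lambda>x. S x - x) ^^ m) ((S ^^ t) y))"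
    unfolding g_def fdiff_funpow_diff fdiff_funpow_orbit[OF F(3)[OF \<psi>(1)] S(1)]
    using m by (simp add: fdiff_funpow_const)
  also have "(S ^^ t) y = (S ^^ (t - e 0)) x"
    using t(1) by (simp add: x_def e'_def flip: funpow_add[THEN fun_cong, unfolded o_apply])
  finally have "\<bar>(fdiff ^^ m) g t\<bar> \<le> norm (((\<lambda>x. S x - x) ^^ m) ((S ^^ (t - e 0)) x))"
    using F(4)[OF \<psi>(1)] by simp
  also have "\<dots> \<le> C * \<epsilon> ^ m * norm ((S ^^ (t - e 0)) x)" by (rule C)
  also have "\<dots> \<le> C * \<epsilon> ^ m * (K ^ (H' * m) * M)" using Sx C \<epsilon> by (intro mult_left_mono) auto
  finally have fd: "\<bar>(fdiff ^^ m) g t\<bar> \<le> C * \<epsilon> ^ m * (K ^ (H' * m) * M)" .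
  have "M \<le> g (e' 0)" using psi_le[of 0] by (simp add: g_def e'_def)
  then have "fact m * M \<le> fact m * g (e' 0)" by simp
  also have "\<dots> \<le> real (e' m - e' 0) ^ m * \<bar>(fdiff ^^ m) g t\<bar>" by (rule t)
  also have "\<dots> \<le> real (H' * m) ^ m * (C * \<epsilon> ^ m * (K ^ (H' * m) * M))"
    using span fd by (intro mult_mono power_mono) (auto simp del: of_nat_mult)
  also have "\<dots> = C * real m ^ m * (H' * \<epsilon> * K ^ H') ^ m * M"
    by (simp add: power_mult_distrib power_mult)
  also have "H' * \<epsilon> * K ^ H' = 1 / 6" using H' K by (simp add: \<epsilon>_def)
  finally have "fact m \<le> C * real m ^ m * (1 / 6) ^ m" using M(1) by simp
  also have "\<dots> \<le> C * (3 ^ m * fact m) * (1 / 6) ^ m"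
    using power_self_le_fact[of m] C(1) by (intro mult_right_mono mult_left_mono) auto
  also have "\<dots> = C * fact m * (3 * (1 / 6)) ^ m" by (simp only: power_mult_distrib mult_ac)
  finally have "1 \<le> C * (1 / 2) ^ m" by simp
  then show False using Cm by (simp add: field_simps)
qed

lemma pos_upper_banach_densityD:
  assumes "pos_upper_banach_density A"
  obtains \<delta> n0 where "\<delta> > 0" "\<And>n. n \<ge> n0 \<Longrightarrow> \<exists>k. card (A \<inter> {k..k + n}) \<ge> \<delta> * real n"
proof -
  define f where "f n = (SUP k. real (card (A \<inter> {k..k + n})))" for n
  obtain L where L: "L > 0" "(\<lambda>n. f n / real n) \<longlonglongrightarrow> L"
    using assms unfolding pos_upper_banach_density_def f_def by blast
  have "eventually (\<lambda>n. f n / real n > L / 2) sequentially"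
    using L by (intro order_tendstoD) auto
  then obtain n0 where n0: "\<And>n. n \<ge> n0 \<Longrightarrow> f n / real n > L / 2" unfolding eventually_sequentially by blast
  have "\<exists>k. card (A \<inter> {k..k + n}) \<ge> L / 2 * real n" if n: "n \<ge> max n0 1" for n
  proof -
    have "L / 2 * real n < f n" using n0[of n] n by (simp add: field_simps)
    moreover have "bdd_above (range (\<lambda>k. real (card (A \<inter> {k..k + n}))))"
    proof (rule bdd_aboveI2)
      fix k
      have "card (A \<inter> {k..k + n}) \<le> card {k..k + n}" by (intro card_mono) auto
      then show "real (card (A \<inter> {k..k + n})) \<le> real (Suc n)" by simp
    qed
    ultimately obtain k where "L / 2 * real n < real (card (A \<inter> {k..k + n}))"
      unfolding f_def by (subst (asm) less_cSUP_iff) auto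
    then show ?thesis by (intro exI[of _ k]) simp
  qed
  then show ?thesis using that[of "L / 2" "max n0 1"] L(1) by auto
qed


section \<open>From bounded windows to vanishing operators\<close>

lemma norm_le_cmod_functional:
  fixes \<phi> :: "'a::complex_banach \<Rightarrow> real"
  assumes "linear \<phi>" "cmod \<omega> = 1"
  shows "\<bar>\<phi> v\<bar> \<le> \<bar>\<phi> (\<omega> *\<^sub>C v)\<bar> + \<bar>\<phi> (\<i> *\<^sub>C \<omega> *\<^sub>C v)\<bar>"
proof -
  have "cnj \<omega> * \<omega> = 1" using assms(2) complex_norm_square[of \<omega>] by (simp add: mult.commute)
  \<comment> \<open>Undoing the rotation by the conjugate phase and splitting that phase into real
    and imaginary parts expresses \<open>\<phi> v\<close> by two real values at the rotated
    vector.\<close>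
  then have "v = cnj \<omega> *\<^sub>C \<omega> *\<^sub>C v" by (simp add: scaleC_scaleC scaleC_one)
  also have "cnj \<omega> = of_real (Re \<omega>) + of_real (- Im \<omega>) * \<i>" by (simp add: complex_eq_iff)
  finally have "v = Re \<omega> *\<^sub>R (\<omega> *\<^sub>C v) + (- Im \<omega>) *\<^sub>R (\<i> *\<^sub>C \<omega> *\<^sub>C v)"
    by (simp only: scaleC_add_left scaleC_scaleC[symmetric] scaleC_of_real)
  then have "\<phi> v = \<phi> (Re \<omega> *\<^sub>R (\<omega> *\<^sub>C v) + (- Im \<omega>) *\<^sub>R (\<i> *\<^sub>C \<omega> *\<^sub>C v))"
    by (rule arg_cong)
  also have "\<dots> = Re \<omega> * \<phi> (\<omega> *\<^sub>C v) + (- Im \<omega>) * \<phi> (\<i> *\<^sub>C \<omega> *\<^sub>C v)"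
    by (simp only: linear_add[OF assms(1)] linear_cmul[OF assms(1)] real_scaleR_def)
  finally have "\<bar>\<phi> v\<bar> \<le> \<bar>Re \<omega>\<bar> * \<bar>\<phi> (\<omega> *\<^sub>C v)\<bar> + \<bar>Im \<omega>\<bar> * \<bar>\<phi> (\<i> *\<^sub>C \<omega> *\<^sub>C v)\<bar>"
    by (metis abs_minus_cancel abs_mult abs_triangle_ineq)
  also have "\<dots> \<le> 1 * \<bar>\<phi> (\<omega> *\<^sub>C v)\<bar> + 1 * \<bar>\<phi> (\<i> *\<^sub>C \<omega> *\<^sub>C v)\<bar>"
    using abs_Re_le_cmod[of \<omega>] abs_Im_le_cmod[of \<omega>] assms(2) by (intro add_mono mult_right_mono) auto
  finally show ?thesis by simp
qed

text \<open>\<open>L\<close> depends on \<open>M\<close>, \<open>C\<close> and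
  \<open>\<epsilon>\<close> only, so it can be fixed before the orbit is known. The window is
  written as times 0 to \<open>2 * L\<close> with centre \<open>(S ^^ L) w\<close>, which avoids
  backward powers.\<close>

definition orbit_controlled :: "('a::real_normed_vector \<Rightarrow> 'a) \<Rightarrow> ('a \<Rightarrow> 'a) \<Rightarrow> bool" where
  "orbit_controlled S E \<longleftrightarrow> (\<forall>M>0. \<forall>C>0. \<forall>\<epsilon>>0. \<exists>L. \<forall>\<phi> :: 'a \<Rightarrow> real. \<forall>w.
     linear \<phi> \<longrightarrow> (\<forall>x. \<bar>\<phi> x\<bar> \<le> norm x) \<longrightarrow> norm ((S ^^ L) w) \<le> M \<longrightarrow>
     (\<forall>j\<le>2 * L. \<bar>\<phi> ((S ^^ j) w)\<bar> \<le> C) \<longrightarrow> \<bar>\<phi> (E ((S ^^ L) w))\<bar> \<le> \<epsilon>)"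

context inverse_pair
begin

text \<open>\<open>p\<close> is set by the accuracy \<open>C / 2 ^ p\<close>. Powers of
  \<open>sin2 (2 ^ p)\<close> beyond \<open>m\<close> satisfy the bound \<open>C\<close> by decay
  alone; the first \<open>m\<close> need a window of radius \<open>m * 2 ^ p\<close>, which is the
  choice of \<open>L\<close>.\<close>

lemma orbit_controlled_sin2:
  assumes qd: "quick_decay (sin2 1)"
  shows "orbit_controlled S (sin2 1)"
  unfolding orbit_controlled_def
proof (intro allI impI)
  fix M C \<epsilon> :: real assume pos: "M > 0" "C > 0" "\<epsilon> > 0"
  obtain p where p: "C / \<epsilon> < 2 ^ p" using real_arch_pow[of 2 "C / \<epsilon>"] by auto
  have "linear ((logistic ^^ p) (sin2 1)) \<and> quick_decay ((logistic ^^ p) (sin2 1))"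
    using linear_sin2 qd
    by (induction p) (auto simp: linear_logistic quick_decay_logistic simp del: One_nat_def)
  then have "quick_decay (sin2 (2 ^ p))" by (simp only: logistic_funpow_sin2)
  then obtain D where D: "D > 0" "\<And>n x. norm ((sin2 (2 ^ p) ^^ n) x) \<le> D * (1 / 2) ^ n * norm x"
    unfolding quick_decay_def by (metis zero_less_divide_1_iff zero_less_numeral)
  obtain m where m: "D * M / C < 2 ^ m" using real_arch_pow[of 2 "D * M / C"] by auto
  show "\<exists>L. \<forall>\<phi> :: 'a \<Rightarrow> real. \<forall>w. linear \<phi> \<longrightarrow> (\<forall>x. \<bar>\<phi> x\<bar> \<le> norm x) \<longrightarrow> norm ((S ^^ L) w) \<le> M \<longrightarrow>
     (\<forall>j\<le>2 * L. \<bar>\<phi> ((S ^^ j) w)\<bar> \<le> C) \<longrightarrow> \<bar>\<phi> (sin2 1 ((S ^^ L) w))\<bar> \<le> \<epsilon>"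
  proof (intro exI allI impI)
    fix \<phi> :: "'a \<Rightarrow> real" and w
    let ?L = "m * 2 ^ p"
    assume \<phi>: "linear \<phi>" "\<forall>x. \<bar>\<phi> x\<bar> \<le> norm x" and M: "norm ((S ^^ ?L) w) \<le> M"
      and C: "\<forall>j\<le>2 * ?L. \<bar>\<phi> ((S ^^ j) w)\<bar> \<le> C"
    have "\<bar>\<phi> (((logistic ^^ p) (sin2 1) ^^ j) ((S ^^ ?L) w))\<bar> \<le> C" for j
      unfolding logistic_funpow_sin2
    proof (cases "j \<le> m")
      case True
      then have jL: "j * 2 ^ p \<le> ?L" by simp
      show "\<bar>\<phi> ((sin2 (2 ^ p) ^^ j) ((S ^^ ?L) w))\<bar> \<le> C"
      proof (rule sin2_funpow_bound[OF \<phi>(1) jL])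
        fix i assume "i \<le> ?L + j * 2 ^ p"
        then have "i \<le> 2 * ?L" using jL by linarith
        then show "\<bar>\<phi> ((S ^^ i) w)\<bar> \<le> C" using C by blast
      qed
    next
      case False
      have "\<bar>\<phi> ((sin2 (2 ^ p) ^^ j) ((S ^^ ?L) w))\<bar> \<le> D * (1 / 2) ^ j * norm ((S ^^ ?L) w)"
        using \<phi>(2) D(2) order_trans by blast
      also have "\<dots> \<le> D * (1 / 2) ^ m * M"
        using False D(1) M by (intro mult_mono mult_left_mono power_decreasing) auto
      also have "\<dots> \<le> C" using m pos by (simp add: field_simps)
      finally show "\<bar>\<phi> ((sin2 (2 ^ p) ^^ j) ((S ^^ ?L) w))\<bar> \<le> C" .
    qed
    then have "\<bar>\<phi> ((sin2 1 ^^ 1) ((S ^^ ?L) w))\<bar> \<le> C / 2 ^ p"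
      using \<phi> by (intro iterated_halving[OF linear_sin2 qd]) auto
    also have "\<dots> \<le> \<epsilon>" using p pos by (simp add: field_simps)
    finally show "\<bar>\<phi> (sin2 1 ((S ^^ ?L) w))\<bar> \<le> \<epsilon>" by simp
  qed
qed

lemma orbit_controlled_diff:
  assumes "\<And>x. sin2 1 x = 0"
  shows "orbit_controlled S (\<lambda>x. S x - x)"
  unfolding orbit_controlled_def
proof (intro allI impI)
  fix M C \<epsilon> :: real assume pos: "M > 0" "C > 0" "\<epsilon> > 0"
  \<comment> \<open>\<open>sin2 1\<close> is \<open>- (1/4) R (S - 1)^2\<close>, so its vanishing
    means that \<open>S - 1\<close> squares to zero.\<close>
  have "S (S x) = 2 *\<^sub>R S x - x" for x
  proof -
    have "2 *\<^sub>R x - S x - R x = 0" using assms[of x] by (simp add: sin2_def del: scaleR_left_diff_distrib)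
    then have "S x + R x = 2 *\<^sub>R x" by (simp add: algebra_simps)
    then have "S (S x + R x) = S (2 *\<^sub>R x)" by simp
    then show ?thesis by (simp add: linear_add[OF S] linear_cmul[OF S] SR eq_diff_eq)
  qed
  then have SQ: "S (S x - x) = S x - x" for x by (simp add: linear_diff[OF S] scaleR_2)
  have pow: "(S ^^ n) x = x + real n *\<^sub>R (S x - x)" for n x
  proof (induction n)
    case (Suc n)
    then have "(S ^^ Suc n) x = S x + real n *\<^sub>R S (S x - x)"
      by (simp only: funpow.simps o_apply linear_add[OF S] linear_cmul[OF S])
    then show ?case unfolding SQ by (simp add: algebra_simps)
  qed simp
  \<comment> \<open>\<open>L (S - 1) x\<close> is the difference of the orbit at times
    \<open>2 * L\<close> and \<open>L\<close>, where \<open>\<phi>\<close> is at most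
    \<open>C\<close> in absolute value; division by \<open>L\<close> leaves
    \<open>2 * C / L\<close>.\<close>
  obtain L0 :: nat where L0: "2 * C / \<epsilon> \<le> real L0" using real_arch_simple by blast
  define L where "L = L0 + 1"
  have L: "real L > 0" "2 * C \<le> real L * \<epsilon>" using L0 pos by (simp_all add: L_def field_simps)
  show "\<exists>L. \<forall>\<phi> :: 'a \<Rightarrow> real. \<forall>w. linear \<phi> \<longrightarrow> (\<forall>x. \<bar>\<phi> x\<bar> \<le> norm x) \<longrightarrow> norm ((S ^^ L) w) \<le> M \<longrightarrow>
     (\<forall>j\<le>2 * L. \<bar>\<phi> ((S ^^ j) w)\<bar> \<le> C) \<longrightarrow> \<bar>\<phi> (S ((S ^^ L) w) - (S ^^ L) w)\<bar> \<le> \<epsilon>"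
  proof (intro exI allI impI)
    fix \<phi> :: "'a \<Rightarrow> real" and w
    define x where "x = (S ^^ L) w"
    assume \<phi>: "linear \<phi>" and C: "\<forall>j\<le>2 * L. \<bar>\<phi> ((S ^^ j) w)\<bar> \<le> C"
    have "(S ^^ (2 * L)) w = (S ^^ L) x" by (simp only: x_def mult_2 funpow_add o_apply)
    then have "\<phi> ((S ^^ (2 * L)) w) = \<phi> x + real L * \<phi> (S x - x)"
      unfolding pow[of L x] by (simp only: linear_add[OF \<phi>] linear_cmul[OF \<phi>] real_scaleR_def)
    moreover have "\<bar>\<phi> ((S ^^ (2 * L)) w)\<bar> \<le> C" by (rule C[rule_format]) simp
    moreover have "\<bar>\<phi> x\<bar> \<le> C" unfolding x_def by (rule C[rule_format]) simp
    ultimately have "\<bar>real L * \<phi> (S x - x)\<bar> \<le> 2 * C" by linarith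
    also note L(2)
    finally have "\<bar>\<phi> (S x - x)\<bar> \<le> \<epsilon>" using L(1) by (simp add: abs_mult)
    then show "\<bar>\<phi> (S ((S ^^ L) w) - (S ^^ L) w)\<bar> \<le> \<epsilon>" by (simp only: x_def)
  qed
qed

end

text \<open>The window sees \<open>E\<close> only near \<open>\<omega> *\<^sub>C v\<close> with
  \<open>\<omega>\<close> unknown; \<open>\<phi>\<close> and its composition with i together recover
  \<open>norm (E v)\<close>. A bound \<open>C\<close> valid for all \<open>r\<close> and
  \<open>L\<close> lets the error go to 0.\<close>

lemma orbit_controlled_imp_zero:
  fixes S E :: "'a::complex_banach \<Rightarrow> 'a"
  assumes E: "bounded_clinear_op E" and ctrl: "orbit_controlled S E"
    and approx: "\<And>(\<phi> :: 'a \<Rightarrow> real) r L. linear \<phi> \<Longrightarrow> (\<And>x. \<bar>\<phi> x\<bar> \<le> norm x) \<Longrightarrow> 0 < r \<Longrightarrow> r \<le> 1 \<Longrightarrow>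
      \<exists>w \<omega>. cmod \<omega> = 1 \<and> norm ((S ^^ L) w - \<omega> *\<^sub>C v) < r \<and>
        (\<forall>j\<le>2 * L. \<bar>\<phi> ((S ^^ j) w)\<bar> \<le> C \<and> \<bar>\<phi> (\<i> *\<^sub>C (S ^^ j) w)\<bar> \<le> C)"
    and C: "C > 0"
  shows "E v = 0"
proof -
  obtain \<phi> :: "'a \<Rightarrow> real" where \<phi>: "linear \<phi>" "\<And>x. \<bar>\<phi> x\<bar> \<le> norm x" "\<phi> (E v) = norm (E v)"
    using norming_functional[of "E v"] by blast
  have Ec: "E (a *\<^sub>C x) = a *\<^sub>C E x" for a x using E unfolding bounded_clinear_op_def by blast
  have lE: "linear E" by (rule bounded_linear.linear[OF bounded_clinear_op_bounded_linear[OF E]])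
  obtain K where K: "K > 0" "\<And>x. norm (E x) \<le> norm x * K"
    using bounded_linear.pos_bounded[OF bounded_clinear_op_bounded_linear[OF E]] by blast
  define \<phi>' where "\<phi>' x = \<phi> (\<i> *\<^sub>C x)" for x
  have \<phi>': "linear \<phi>'" "\<And>x. \<bar>\<phi>' x\<bar> \<le> norm x"
    unfolding \<phi>'_def using linear_compose[OF linear_scaleC \<phi>(1)] \<phi>(2)[of "\<i> *\<^sub>C _"]
    by (simp_all add: o_def norm_scaleC)
  have "norm (E v) \<le> 0 + e" if e: "e > 0" for e
  proof -
    \<comment> \<open>Two functionals, each with error \<open>e / 4 + r * K\<close>, must total at
      most \<open>e\<close>.\<close>
    define r where "r = min 1 (e / (4 * K))"
    have r: "r > 0" "r \<le> 1" "2 * (r * K) \<le> e / 2" using that K by (auto simp: r_def min_def field_simps)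
    have "norm v + 1 > 0" "e / 4 > 0" using e by (auto simp: add_nonneg_pos)
    then have "\<exists>L. \<forall>\<phi> :: 'a \<Rightarrow> real. \<forall>w. linear \<phi> \<longrightarrow> (\<forall>x. \<bar>\<phi> x\<bar> \<le> norm x) \<longrightarrow>
        norm ((S ^^ L) w) \<le> norm v + 1 \<longrightarrow> (\<forall>j\<le>2 * L. \<bar>\<phi> ((S ^^ j) w)\<bar> \<le> C) \<longrightarrow>
        \<bar>\<phi> (E ((S ^^ L) w))\<bar> \<le> e / 4"
      using ctrl C unfolding orbit_controlled_def by (simp only: simp_thms)
    then obtain L where L: "\<forall>\<phi> :: 'a \<Rightarrow> real. \<forall>w. linear \<phi> \<longrightarrow> (\<forall>x. \<bar>\<phi> x\<bar> \<le> norm x) \<longrightarrow>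
        norm ((S ^^ L) w) \<le> norm v + 1 \<longrightarrow> (\<forall>j\<le>2 * L. \<bar>\<phi> ((S ^^ j) w)\<bar> \<le> C) \<longrightarrow>
        \<bar>\<phi> (E ((S ^^ L) w))\<bar> \<le> e / 4" ..
    obtain w \<omega> where w: "cmod \<omega> = 1" "norm ((S ^^ L) w - \<omega> *\<^sub>C v) < r"
        "\<And>j. j \<le> 2 * L \<Longrightarrow> \<bar>\<phi> ((S ^^ j) w)\<bar> \<le> C \<and> \<bar>\<phi> (\<i> *\<^sub>C (S ^^ j) w)\<bar> \<le> C"
      using approx[OF \<phi>(1,2) r(1,2), of L] by blast
    define x where "x = (S ^^ L) w"
    have "norm x \<le> norm (\<omega> *\<^sub>C v) + norm (x - \<omega> *\<^sub>C v)" by (metis norm_triangle_sub)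
    then have x: "norm x \<le> norm v + 1" using w(1,2) r by (simp add: x_def norm_scaleC)
    have near: "\<bar>\<psi> (\<omega> *\<^sub>C E v)\<bar> \<le> e / 4 + r * K"
      if \<psi>: "linear \<psi>" "\<And>x. \<bar>\<psi> x\<bar> \<le> norm x" "\<And>j. j \<le> 2 * L \<Longrightarrow> \<bar>\<psi> ((S ^^ j) w)\<bar> \<le> C" for \<psi>
    proof -
      have "\<bar>\<psi> (E x)\<bar> \<le> e / 4" unfolding x_def by (rule L[rule_format]) (use \<psi> x in \<open>auto simp: x_def\<close>)
      moreover have "norm (E (x - \<omega> *\<^sub>C v)) \<le> r * K"
        by (rule order_trans[OF K(2)]) (use w(2) K(1) in \<open>simp add: x_def\<close>)
      then have "\<bar>\<psi> (E (x - \<omega> *\<^sub>C v))\<bar> \<le> r * K" using \<psi>(2) order_trans by blast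
      moreover have "\<psi> (\<omega> *\<^sub>C E v) = \<psi> (E x) - \<psi> (E (x - \<omega> *\<^sub>C v))"
        by (simp add: linear_diff[OF lE] linear_diff[OF \<psi>(1)] Ec)
      ultimately show ?thesis by linarith
    qed
    have "\<bar>\<phi> (\<omega> *\<^sub>C E v)\<bar> \<le> e / 4 + r * K" by (rule near) (use \<phi> w in auto)
    moreover have "\<bar>\<phi>' (\<omega> *\<^sub>C E v)\<bar> \<le> e / 4 + r * K" 
      by (rule near) (use \<phi>' w(3) in \<open>auto simp: \<phi>'_def[of "(S ^^ _) w"]\<close>)
    moreover have "norm (E v) \<le> \<bar>\<phi> (\<omega> *\<^sub>C E v)\<bar> + \<bar>\<phi>' (\<omega> *\<^sub>C E v)\<bar>"
      using norm_le_cmod_functional[OF \<phi>(1) w(1), of "E v"] \<phi>(3) by (simp add: \<phi>'_def)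
    ultimately show ?thesis using r(3) by linarith
  qed
  then have "norm (E v) \<le> 0" by (rule field_le_epsilon)
  then show ?thesis by simp
qed

theorem mainTheorem15:
  fixes T :: "'a::complex_banach \<Rightarrow> 'a" and lam :: complex
  assumes "separable_space TYPE('a)"
    and "bounded_clinear_op T"
    and "P_BD T"
    and "cmod lam = 1"
  shows "T = (\<lambda>x. lam *\<^sub>C x) \<or> \<not> quasinilpotent (\<lambda>x. T x - lam *\<^sub>C x)"
proof (rule disjCI)
  assume "\<not> \<not> quasinilpotent (\<lambda>x. T x - lam *\<^sub>C x)"
  then have qn: "quasinilpotent (\<lambda>x. T x - lam *\<^sub>C x)" by simp
  have lam: "lam \<noteq> 0" using assms(4) by auto
  have T: "linear T" by (rule bounded_linear.linear[OF bounded_clinear_op_bounded_linear[OF assms(2)]])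
  have Tc: "T (a *\<^sub>C x) = a *\<^sub>C T x" for a x using assms(2) unfolding bounded_clinear_op_def by blast
  obtain K where K: "K > 0" "\<And>x. norm (T x) \<le> norm x * K"
    using bounded_linear.pos_bounded[OF bounded_clinear_op_bounded_linear[OF assms(2)]] by blast
  define N where "N x = T x - lam *\<^sub>C x" for x
  have "norm (N x) \<le> (K + 1) * norm x" for x
    using norm_triangle_ineq4[of "T x" "lam *\<^sub>C x"] K(2)[of x] assms(4)
    by (simp add: N_def norm_scaleC algebra_simps)
  then have "\<exists>K. \<forall>x. norm (N x) \<le> K * norm x" by blast
  then have N: "bounded_clinear_op N"
    unfolding bounded_clinear_op_def
    by (simp add: N_def linear_add[OF T] Tc scaleC_add_right scaleC_diff_right scaleC_scaleC mult.commute)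
  have "quick_decay N" using quasinilpotent_imp_quick_decay[OF N] qn by (simp add: N_def[abs_def])
  define S where "S x = (1 / lam) *\<^sub>C T x" for x
  have Sc: "S (a *\<^sub>C x) = a *\<^sub>C S x" for a x by (simp add: S_def Tc scaleC_scaleC mult.commute)
  have S: "linear S" unfolding S_def[abs_def] using linear_compose[OF T linear_scaleC] by (simp add: o_def)
  have NS: "N ((1 / lam) *\<^sub>C x) = S x - x" for x
    using lam by (simp add: N_def S_def Tc scaleC_scaleC scaleC_one)
  have "quick_decay (\<lambda>x. N ((1 / lam) *\<^sub>C x))"
    using N assms(4) \<open>quick_decay N\<close>
    by (intro quick_decay_compose[where a = N and b = "\<lambda>x. (1 / lam) *\<^sub>C x" and K = 1]) (auto simp: norm_scaleC norm_divide bounded_clinear_op_def)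
  then have Q: "quick_decay (\<lambda>x. S x - x)" by (simp add: NS)
  \<comment> \<open>\<open>- lam\<close> is nonzero, hence outside the spectrum of \<open>N\<close>,
    and \<open>N + lam = T\<close>: this inverts \<open>T\<close>.\<close>
  have "- lam \<notin> op_spectrum N" using qn lam by (simp add: quasinilpotent_def N_def[abs_def])
  then obtain P where P: "bounded_clinear_op P" "\<And>x. P (N x - (- lam) *\<^sub>C x) = x" "\<And>x. N (P x) - (- lam) *\<^sub>C P x = x"
    unfolding op_spectrum_def by blast
  have PT: "P (T x) = x" "T (P x) = x" for x
    using P(2,3)[of x] by (simp_all add: N_def scaleC_minus_left)
  have Pc: "P (a *\<^sub>C x) = a *\<^sub>C P x" for a x using P(1) unfolding bounded_clinear_op_def by blast
  have linP: "linear P" by (rule bounded_linear.linear[OF bounded_clinear_op_bounded_linear[OF P(1)]])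
  define R where "R x = lam *\<^sub>C P x" for x
  have R: "linear R" unfolding R_def[abs_def] using linear_compose[OF linP linear_scaleC] by (simp add: o_def)
  interpret inverse_pair S R
  proof unfold_locales
    show "S (R x) = x" "R (S x) = x" for x
      using lam by (simp_all add: S_def R_def Tc Pc PT scaleC_scaleC scaleC_one)
  qed (simp_all add: linear_add[OF S] linear_add[OF R] linear_cmul[OF S] linear_cmul[OF R])
  obtain K' where K': "K' > 0" "\<And>x. norm (P x) \<le> norm x * K'"
    using bounded_linear.pos_bounded[OF bounded_clinear_op_bounded_linear[OF P(1)]] by blast
  have normS: "norm (S x) \<le> (K + 1) * norm x" for x
    using K(2)[of x] assms(4) by (simp add: S_def norm_scaleC norm_divide algebra_simps add_increasing)
  have normR: "norm (R x) \<le> K' * norm x" for x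
    using K'(2)[of x] assms(4) by (simp add: R_def norm_scaleC mult.commute)
  have Spow: "(S ^^ n) x = (1 / lam) ^ n *\<^sub>C (T ^^ n) x" for n x
    by (induction n) (simp_all add: scaleC_one S_def Tc scaleC_scaleC mult.commute)
  have approx: "\<exists>w \<omega>. cmod \<omega> = 1 \<and> norm ((S ^^ L) w - \<omega> *\<^sub>C v) < r \<and>
        (\<forall>j\<le>2 * L. \<bar>\<phi> ((S ^^ j) w)\<bar> \<le> 2 * (norm v + 1) \<and> \<bar>\<phi> (\<i> *\<^sub>C (S ^^ j) w)\<bar> \<le> 2 * (norm v + 1))"
    if \<phi>: "linear \<phi>" "\<And>x. \<bar>\<phi> x\<bar> \<le> norm x" and r: "0 < r" "r \<le> 1" for \<phi> :: "'a \<Rightarrow> real" and r v L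
  proof -
    obtain y where y: "pos_upper_banach_density (return_set T y (ball v r))"
      using assms(3) r(1) unfolding P_BD_def by (metis centre_in_ball empty_iff open_ball)
    define A where "A = return_set T y (ball v r)"
    obtain \<delta> n0 where \<delta>: "\<delta> > 0" "\<And>n. n \<ge> n0 \<Longrightarrow> \<exists>k. card (A \<inter> {k..k + n}) \<ge> \<delta> * real n"
      using pos_upper_banach_densityD[OF y] unfolding A_def by blast
    \<comment> \<open>Powers of \<open>1 / lam\<close> are isometric, so a visit of \<open>T\<close>
      to the ball about \<open>v\<close> is a visit of \<open>S\<close> to the ball about a rotated
      \<open>v\<close>.\<close>
    have close: "norm ((S ^^ a) y - (1 / lam) ^ a *\<^sub>C v) < r" if "a \<in> A" for a
    proof -
      have "norm ((S ^^ a) y - (1 / lam) ^ a *\<^sub>C v) = norm ((T ^^ a) y - v)"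
        unfolding Spow scaleC_diff_right[symmetric] norm_scaleC
        using assms(4) by (simp add: norm_power norm_divide)
      then show ?thesis using that by (simp add: A_def return_set_def dist_norm norm_minus_commute)
    qed
    have bd: "norm ((S ^^ a) y) \<le> norm v + 1" if "a \<in> A" for a
    proof -
      have "norm ((S ^^ a) y) \<le> norm ((1 / lam) ^ a *\<^sub>C v) + norm ((S ^^ a) y - (1 / lam) ^ a *\<^sub>C v)"
        by (metis norm_triangle_sub)
      then show ?thesis using close[OF that] r assms(4) by (simp add: norm_scaleC norm_power norm_divide)
    qed
    define F where "F = {\<phi>, \<lambda>x. - \<phi> x, \<lambda>x. \<phi> (\<i> *\<^sub>C x), \<lambda>x. - \<phi> (\<i> *\<^sub>C x)}"
    have lin: "linear (\<lambda>x. \<phi> (\<i> *\<^sub>C x))"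
      using linear_compose[OF linear_scaleC \<phi>(1)] by (simp add: o_def)
    have "\<exists>a\<in>A. L \<le> a \<and> (\<forall>j \<psi>. a \<le> j + L \<longrightarrow> j \<le> a + L \<longrightarrow> \<psi> \<in> F \<longrightarrow> \<psi> ((S ^^ j) y) \<le> 2 * (norm v + 1))"
    proof (rule bounded_orbit_near_return[OF S normS _ Q _ _ _ _ _ bd \<delta>])
      show "linear \<psi>" if "\<psi> \<in> F" for \<psi>
        using that \<phi>(1) lin by (auto simp: F_def intro: linear_compose_neg)
      show "\<bar>\<psi> x\<bar> \<le> norm x" if "\<psi> \<in> F" for \<psi> x
        using that \<phi>(2)[of x] \<phi>(2)[of "\<i> *\<^sub>C x"] by (auto simp: F_def norm_scaleC)
    qed (use K in \<open>auto simp: F_def add_nonneg_pos\<close>)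
    then obtain a where a: "a \<in> A" "L \<le> a"
      "\<And>j \<psi>. a \<le> j + L \<Longrightarrow> j \<le> a + L \<Longrightarrow> \<psi> \<in> F \<Longrightarrow> \<psi> ((S ^^ j) y) \<le> 2 * (norm v + 1)" by blast
    \<comment> \<open>Restarting \<open>L\<close> steps before the return turns the window around
      \<open>a\<close> into the times 0 to \<open>2 * L\<close>.\<close>
    define w where "w = (S ^^ (a - L)) y"
    have w: "(S ^^ j) w = (S ^^ (j + (a - L))) y" for j by (simp add: w_def funpow_add)
    show ?thesis
    proof (intro exI conjI allI impI)
      show "cmod ((1 / lam) ^ a) = 1" using assms(4) by (simp add: norm_power norm_divide)
      show "norm ((S ^^ L) w - (1 / lam) ^ a *\<^sub>C v) < r" using close[OF a(1)] a(2) by (simp add: w)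
      fix j assume j: "j \<le> 2 * L"
      have *: "\<psi> ((S ^^ j) w) \<le> 2 * (norm v + 1)" if "\<psi> \<in> F" for \<psi>
        unfolding w using that j a(2) by (intro a(3)) auto
      show "\<bar>\<phi> ((S ^^ j) w)\<bar> \<le> 2 * (norm v + 1)"
        using *[of \<phi>] *[of "\<lambda>x. - \<phi> x"] by (simp add: F_def abs_le_iff)
      show "\<bar>\<phi> (\<i> *\<^sub>C (S ^^ j) w)\<bar> \<le> 2 * (norm v + 1)"
        using *[of "\<lambda>x. \<phi> (\<i> *\<^sub>C x)"] *[of "\<lambda>x. - \<phi> (\<i> *\<^sub>C x)"] by (simp add: F_def abs_le_iff)
    qed
  qed
  have zero: "E v = 0" if "bounded_clinear_op E" "orbit_controlled S E" for E v
    by (rule orbit_controlled_imp_zero[OF that, of v "2 * (norm v + 1)"]) (use approx in \<open>auto simp: add_nonneg_pos\<close>)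
  have diffc: "bounded_clinear_op (\<lambda>x. S x - x)"
    unfolding bounded_clinear_op_def
    using quick_decay_bounded_op[OF Q] by (simp add: linear_add[OF S] Sc scaleC_diff_right)
  have qds: "quick_decay (sin2 1)"
    using K'(1) by (intro quick_decay_sin2[OF Q normR]) auto
  have "sin2 1 (a *\<^sub>C x) = a *\<^sub>C sin2 1 x" for a x
    by (simp add: sin2_def Sc R_def Pc scaleC_scaleC scaleC_diff_right linear_cmul[OF linear_scaleC] mult.commute)
  then have "bounded_clinear_op (sin2 1)"
    unfolding bounded_clinear_op_def
    using quick_decay_bounded_op[OF qds] linear_add[OF linear_sin2] by blast
  then have "sin2 1 x = 0" for x by (rule zero[OF _ orbit_controlled_sin2[OF qds]])
  then have "S x - x = 0" for x by (rule zero[OF diffc orbit_controlled_diff])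
  then have "T x = lam *\<^sub>C x" for x
    using lam by (simp add: S_def) (metis divide_self_if scaleC_one scaleC_scaleC times_divide_eq_right mult.right_neutral)
  then show "T = (\<lambda>x. lam *\<^sub>C x)" by auto
qed

end
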